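(* For every even ordinal $\alpha$ with $4\leq \alpha<\omega_1$ there exists a Tychonoff topological space $T_\alpha$ with the following properties: (i) $T_\alpha$ is an $F_{\sigma\delta}$ space (that is, an $\mathcal F_3$ space); (ii) $T_\alpha$ is not an absolute $\mathcal F_\alpha$ space; (iii) $T_\alpha$ is an absolute $\mathcal F_{\alpha+1}$ space.
   Context: All topological spaces are Tychonoff (in particular Hausdorff). For a family of sets $\mathcal C$, $\mathcal C_\sigma$ (resp. $\mathcal C_\delta$) is the collection of all countable unions (resp. countable intersections) of elements of $\mathcal C$. An ordinal $\lambda+n$, with $\lambda$ zero or limit and $n\in\omega$, is even/odd according to the parity of $n$. $\mathcal F$-Borel classes on a space $Y$: $\mathcal F_1(Y)$ is the family of closed subsets of $Y$; for $2\le\alpha<\omega_1$ even, $\mathcal F_\alpha(Y)=\left(\bigcup_{\beta<\alpha}\mathcal F_\beta(Y)\right)_\sigma$; for $3\le\alpha<\omega_1$ odd, $\mathcal F_\alpha(Y)=\left(\bigcup_{\beta<\alpha}\mathcal F_\beta(Y)\right)_\delta$ (here $1\le\beta<\alpha$). In particular $\mathcal F_3=F_{\sigma\delta}$. A compactification of $X$ is a compact (Hausdorff) space $cX$ containing (a homeomorphic copy of) $X$ as a dense subspace. $X$ is an $\mathcal F_\alpha$ space if $X\in\mathcal F_\alpha(cX)$ for some compactification $cX$ of $X$. $X$ is an absolute $\mathcal F_\alpha$ space if $X\in\mathcal F_\alpha(Y)$ for every Tychonoff space $Y$ in which $X$ is densely embedded. *)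

theory Defs
  imports "HOL-Analysis.Analysis" "HOL-Library.Countable_Set_Type"
begin

section \<open>Countable ordinals\<close>

text \<open>
  The elements of \<open>\<omega>\<^sub>1\<close> are the ordinals \<open>\<alpha> < \<omega>\<^sub>1\<close>. The ordinal \<open>\<omega>\<^sub>1\<close> is realised by the
  (unique up to isomorphism) well-order of type \<open>\<aleph>\<^sub>1\<close> given by the library; \<open>countable_below\<close>
  and \<open>uncountable_omega1\<close> below characterise its order type.
\<close>

typedef omega1 = "Field (cardSuc natLeq)"
proof -
  have "infinite (Field (cardSuc natLeq))"
    using Cinfinite_cardSuc[OF natLeq_Cinfinite] by (simp add: cinfinite_def)
  then show ?thesis by (metis ex_in_conv finite.emptyI)
qed

lemma omega1_card_order: "Card_order (cardSuc natLeq)"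
  by (simp add: cardSuc_Card_order natLeq_Card_order)

lemma omega1_well_order: "Well_order (cardSuc natLeq)"
  using omega1_card_order by (simp add: card_order_on_def)

instantiation omega1 :: wellorder
begin

definition less_eq_omega1 :: "omega1 \<Rightarrow> omega1 \<Rightarrow> bool"
  where "\<alpha> \<le> \<beta> \<longleftrightarrow> (Rep_omega1 \<alpha>, Rep_omega1 \<beta>) \<in> cardSuc natLeq"

definition less_omega1 :: "omega1 \<Rightarrow> omega1 \<Rightarrow> bool"
  where "\<alpha> < \<beta> \<longleftrightarrow> \<alpha> \<le> \<beta> \<and> \<not> \<beta> \<le> (\<alpha> :: omega1)"

instance
proof
  note wo = omega1_well_order[unfolded well_order_on_def linear_order_on_def
      partial_order_on_def preorder_on_def]
  fix x y z :: omega1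
  show "x < y \<longleftrightarrow> x \<le> y \<and> \<not> y \<le> x" by (rule less_omega1_def)
  show "x \<le> x"
    using wo Rep_omega1[of x] unfolding less_eq_omega1_def refl_on_def by blast
  show "x \<le> y \<Longrightarrow> y \<le> z \<Longrightarrow> x \<le> z"
    using wo unfolding less_eq_omega1_def trans_def by blast
  show antisym: "x \<le> y \<Longrightarrow> y \<le> x \<Longrightarrow> x = y" for x y :: omega1
    using wo unfolding less_eq_omega1_def antisym_def by (metis Rep_omega1_inject)
  show "x \<le> y \<or> y \<le> x"
  proof (cases "x = y")
    case True
    then show ?thesis
      using wo Rep_omega1[of x] unfolding less_eq_omega1_def refl_on_def by blast
  next
    case False
    then show ?thesis
      using wo Rep_omega1[of x] Rep_omega1[of y] unfolding less_eq_omega1_def total_on_def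
      by (metis Rep_omega1_inject)
  qed
  fix P :: "omega1 \<Rightarrow> bool" and a :: omega1
  assume step: "\<And>x. (\<And>y. y < x \<Longrightarrow> P y) \<Longrightarrow> P x"
  have "wf (inv_image (cardSuc natLeq - Id) Rep_omega1)"
    using wo by (intro wf_inv_image) blast
  moreover have "{(x, y). x < y} \<subseteq> inv_image (cardSuc natLeq - Id) Rep_omega1"
    unfolding less_omega1_def less_eq_omega1_def by (auto simp: inv_image_def)
  ultimately have "wf {(x :: omega1, y). x < y}"
    by (rule wf_subset)
  then show "P a"
    using step by (induction a rule: wf_induct_rule) blast
qed

end

lemma countable_below: "countable {..< \<alpha> :: omega1}"
proof -
  include cardinal_syntax
  have sub: "Rep_omega1 ` {..<\<alpha>} \<subseteq> underS (cardSuc natLeq) (Rep_omega1 \<alpha>)"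
    by (auto simp: underS_def less_omega1_def less_eq_omega1_def)
  have "|underS (cardSuc natLeq) (Rep_omega1 \<alpha>)| <o cardSuc natLeq"
    by (intro card_of_underS omega1_card_order Rep_omega1)
  then have "|underS (cardSuc natLeq) (Rep_omega1 \<alpha>)| \<le>o natLeq"
    by (simp add: cardSuc_ordLeq_ordLess natLeq_Card_order card_of_Card_order)
  then have "countable (underS (cardSuc natLeq) (Rep_omega1 \<alpha>))"
    by (simp add: countable_card_le_natLeq)
  with sub have "countable (Rep_omega1 ` {..<\<alpha>})"
    by (rule countable_subset)
  then show ?thesis
    by (rule countable_image_inj_on) (simp add: inj_on_def Rep_omega1_inject)
qed

lemma uncountable_omega1: "uncountable (UNIV :: omega1 set)"
proof
  include cardinal_syntax
  assume "countable (UNIV :: omega1 set)"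
  then have "countable (range Rep_omega1)" by simp
  moreover have "range Rep_omega1 = Field (cardSuc natLeq)"
    by (simp add: type_definition.Rep_range[OF type_definition_omega1])
  ultimately have "|Field (cardSuc natLeq)| \<le>o natLeq"
    by (simp add: countable_card_le_natLeq)
  then have "cardSuc natLeq \<le>o natLeq"
    using card_of_Field_ordIso[OF omega1_card_order] ordIso_ordLeq_trans ordIso_symmetric by blast
  then show False
    using cardSuc_greater[OF natLeq_Card_order] not_ordLess_ordLeq by blast
qed

definition osuc :: "omega1 \<Rightarrow> omega1"
  where "osuc \<alpha> = (LEAST \<beta>. \<alpha> < \<beta>)"

definition ord_of_nat :: "nat \<Rightarrow> omega1"
  where "ord_of_nat n = (osuc ^^ n) (LEAST \<alpha>. True)"

lemma less_osuc: "\<alpha> < osuc \<alpha>"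
proof -
  have "countable {..\<alpha>}"
    using countable_below[of \<alpha>] by (simp add: lessThan_Suc_atMost flip: ivl_disj_un_singleton(2))
  then have "{..\<alpha>} \<noteq> UNIV" using uncountable_omega1 by metis
  then have "\<exists>\<beta>. \<alpha> < \<beta>" by (auto simp: not_le)
  then show ?thesis unfolding osuc_def by (rule LeastI_ex)
qed

lemma less_osuc_iff: "\<alpha> < osuc \<beta> \<longleftrightarrow> \<alpha> \<le> \<beta>"
proof
  show "\<alpha> \<le> \<beta>" if "\<alpha> < osuc \<beta>"
    using not_less_Least[OF that[unfolded osuc_def]] by (simp add: not_less)
  show "\<alpha> < osuc \<beta>" if "\<alpha> \<le> \<beta>"
    using that less_osuc by (rule le_less_trans)
qed

definition zero_or_limit :: "omega1 \<Rightarrow> bool"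
  where "zero_or_limit \<gamma> \<longleftrightarrow> \<gamma> \<notin> range osuc"

definition even_ord :: "omega1 \<Rightarrow> bool"
  where "even_ord \<alpha> \<longleftrightarrow> (\<exists>\<gamma> n. zero_or_limit \<gamma> \<and> even n \<and> \<alpha> = (osuc ^^ n) \<gamma>)"

definition odd_ord :: "omega1 \<Rightarrow> bool"
  where "odd_ord \<alpha> \<longleftrightarrow> (\<exists>\<gamma> n. zero_or_limit \<gamma> \<and> odd n \<and> \<alpha> = (osuc ^^ n) \<gamma>)"

lemma inj_osuc: "inj osuc"
proof (rule injI)
  fix \<alpha> \<beta> assume eq: "osuc \<alpha> = osuc \<beta>"
  have "\<alpha> \<le> \<beta>" using less_osuc[of \<alpha>] eq by (simp add: less_osuc_iff)
  moreover have "\<beta> \<le> \<alpha>" using less_osuc[of \<beta>] eq by (simp flip: less_osuc_iff)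
  ultimately show "\<alpha> = \<beta>" by simp
qed

lemma odd_ord_iff_not_even_ord: "odd_ord \<alpha> \<longleftrightarrow> \<not> even_ord \<alpha>"
proof -
  have ex: "\<exists>\<gamma> n. zero_or_limit \<gamma> \<and> \<alpha> = (osuc ^^ n) \<gamma>"
  proof (induction \<alpha> rule: less_induct)
    case (less \<alpha>)
    show ?case
    proof (cases "zero_or_limit \<alpha>")
      case True
      then show ?thesis by (metis funpow_0)
    next
      case False
      then obtain \<beta> where \<beta>: "\<alpha> = osuc \<beta>" by (auto simp: zero_or_limit_def)
      then obtain \<gamma> n where "zero_or_limit \<gamma>" "\<beta> = (osuc ^^ n) \<gamma>"
        using less less_osuc by blast
      then have "\<alpha> = (osuc ^^ Suc n) \<gamma>" using \<beta> by simp
      with \<open>zero_or_limit \<gamma>\<close> show ?thesis by blast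
    qed
  qed
  have uniq: "m = n"
    if "zero_or_limit \<gamma>" "zero_or_limit \<mu>" "(osuc ^^ m) \<gamma> = (osuc ^^ n) \<mu>" for m n \<gamma> \<mu>
    using that(3)
  proof (induction m arbitrary: n)
    case 0
    then show ?case using that(1) by (cases n) (auto simp: zero_or_limit_def)
  next
    case (Suc m)
    then show ?case
      using that(2) by (cases n) (auto simp: zero_or_limit_def inj_eq[OF inj_osuc])
  qed
  show ?thesis
    unfolding even_ord_def odd_ord_def using ex uniq by metis
qed


section \<open>The \<open>\<F>\<close>-Borel hierarchy\<close>

definition countable_unions :: "'a set set \<Rightarrow> 'a set set"
  where "countable_unions \<C> = {\<Union>\<U> |\<U>. countable \<U> \<and> \<U> \<subseteq> \<C>}"

text \<open>The empty intersection is the whole space, as for \<^const>\<open>gdelta_in\<close>.\<close>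

definition countable_intersections :: "'a topology \<Rightarrow> 'a set set \<Rightarrow> 'a set set"
  where "countable_intersections Y \<C> =
    {topspace Y \<inter> \<Inter>\<U> |\<U>. countable \<U> \<and> \<U> \<subseteq> \<C>}"

text \<open>The hierarchy starts at index \<open>1\<close>; the value at index \<open>0\<close> is irrelevant.\<close>

function F_Borel :: "'a topology \<Rightarrow> omega1 \<Rightarrow> 'a set set"
  where "F_Borel Y \<alpha> =
    (if \<alpha> \<le> ord_of_nat 1 then Collect (closedin Y)
     else if even_ord \<alpha> then countable_unions (\<Union>\<beta>\<in>{ord_of_nat 1..<\<alpha>}. F_Borel Y \<beta>)
     else countable_intersections Y (\<Union>\<beta>\<in>{ord_of_nat 1..<\<alpha>}. F_Borel Y \<beta>))"
  by auto
termination
  by (relation "inv_image {(\<beta>, \<alpha>). \<beta> < \<alpha>} snd") (auto simp: wf)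

declare F_Borel.simps [simp del]

lemma F_Borel_first: "\<alpha> \<le> ord_of_nat 1 \<Longrightarrow> F_Borel Y \<alpha> = Collect (closedin Y)"
  by (subst F_Borel.simps) (rule if_P)

lemma F_Borel_even:
  "\<not> \<alpha> \<le> ord_of_nat 1 \<Longrightarrow> even_ord \<alpha> \<Longrightarrow>
    F_Borel Y \<alpha> = countable_unions (\<Union>\<beta>\<in>{ord_of_nat 1..<\<alpha>}. F_Borel Y \<beta>)"
  by (subst F_Borel.simps) (simp only: if_False if_True)

lemma F_Borel_odd:
  "\<not> \<alpha> \<le> ord_of_nat 1 \<Longrightarrow> \<not> even_ord \<alpha> \<Longrightarrow>
    F_Borel Y \<alpha> = countable_intersections Y (\<Union>\<beta>\<in>{ord_of_nat 1..<\<alpha>}. F_Borel Y \<beta>)"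
  by (subst F_Borel.simps) (simp only: if_False)

lemma F_Borel_subset: "S \<in> F_Borel Y \<alpha> \<Longrightarrow> S \<subseteq> topspace Y"
proof (induction \<alpha> arbitrary: S rule: less_induct)
  case (less \<alpha>)
  let ?C = "\<Union>\<beta>\<in>{ord_of_nat 1..<\<alpha>}. F_Borel Y \<beta>"
  have C: "U \<subseteq> topspace Y" if "U \<in> ?C" for U
    using that less.IH by (meson UN_E atLeastLessThan_iff)
  consider "closedin Y S" | "S \<in> countable_unions ?C" | "S \<in> countable_intersections Y ?C"
    using less.prems F_Borel_first[of \<alpha> Y] F_Borel_even[of \<alpha> Y] F_Borel_odd[of \<alpha> Y]
    by (metis mem_Collect_eq)
  then show ?case
  proof cases
    case 1
    then show ?thesis by (rule closedin_subset)
  next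
    case 2
    then obtain \<U> where "\<U> \<subseteq> ?C" "\<Union>\<U> = S"
      unfolding countable_unions_def by blast
    then show ?thesis using C by blast
  next
    case 3
    then show ?thesis
      unfolding countable_intersections_def by blast
  qed
qed

lemma F_Borel_homeomorphic_image:
  assumes f: "homeomorphic_map Y Z f" and S: "S \<in> F_Borel Y \<alpha>"
  shows "f ` S \<in> F_Borel Z \<alpha>"
  using S
proof (induction \<alpha> arbitrary: S rule: less_induct)
  case (less \<alpha>)
  let ?C = "\<lambda>Y. \<Union>\<beta>\<in>{ord_of_nat 1..<\<alpha>}. F_Borel Y \<beta>"
  have C: "f ` U \<in> F_Borel Z \<beta>" if "U \<in> F_Borel Y \<beta>" "\<beta> < \<alpha>" for U \<beta>
    using less.IH that by blast
  consider "\<alpha> \<le> ord_of_nat 1" | "\<not> \<alpha> \<le> ord_of_nat 1" "even_ord \<alpha>"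
    | "\<not> \<alpha> \<le> ord_of_nat 1" "\<not> even_ord \<alpha>" by blast
  then show ?case
  proof cases
    case 1
    then show ?thesis
      using less.prems homeomorphic_map_closedness_eq[OF f, of S] by (simp add: F_Borel_first)
  next
    case 2
    with less.prems have "S \<in> countable_unions (?C Y)"
      by (simp only: F_Borel_even[OF 2])
    then obtain \<U> where \<U>: "countable \<U>" "\<U> \<subseteq> ?C Y" "\<Union>\<U> = S"
      unfolding countable_unions_def mem_Collect_eq by metis
    have "(`) f ` \<U> \<subseteq> ?C Z"
    proof (rule image_subsetI)
      fix U assume "U \<in> \<U>"
      then obtain \<beta> where "\<beta> \<in> {ord_of_nat 1..<\<alpha>}" "U \<in> F_Borel Y \<beta>"
        using \<U>(2) by blast
      then show "f ` U \<in> ?C Z" by (intro UN_I[of \<beta>] C) auto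
    qed
    moreover have "countable ((`) f ` \<U>)" "\<Union>((`) f ` \<U>) = f ` S"
      using \<U> by auto
    ultimately have "f ` S \<in> countable_unions (?C Z)"
      unfolding countable_unions_def mem_Collect_eq by metis
    with 2 show ?thesis by (simp only: F_Borel_even[OF 2])
  next
    case 3
    with less.prems have "S \<in> countable_intersections Y (?C Y)"
      by (simp only: F_Borel_odd[OF 3])
    then obtain \<U> where \<U>: "countable \<U>" "\<U> \<subseteq> ?C Y" "topspace Y \<inter> \<Inter>\<U> = S"
      unfolding countable_intersections_def mem_Collect_eq by metis
    have inj: "inj_on f (topspace Y)" and img: "f ` topspace Y = topspace Z"
      using f by (simp_all add: homeomorphic_imp_injective_map homeomorphic_imp_surjective_map)
    have sub: "U \<subseteq> topspace Y" if "U \<in> \<U>" for U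
      using that \<U>(2) F_Borel_subset by blast
    have "topspace Z \<inter> \<Inter>((`) f ` \<U>) = f ` S"
    proof
      show "f ` S \<subseteq> topspace Z \<inter> \<Inter>((`) f ` \<U>)"
        using \<U>(3) img by auto
      show "topspace Z \<inter> \<Inter>((`) f ` \<U>) \<subseteq> f ` S"
      proof
        fix z assume z: "z \<in> topspace Z \<inter> \<Inter>((`) f ` \<U>)"
        then obtain y where y: "y \<in> topspace Y" "z = f y" using img by blast
        have "y \<in> U" if "U \<in> \<U>" for U
          using z that y inj_on_image_mem_iff[OF inj y(1) sub[OF that]] by auto
        with y \<U>(3) show "z \<in> f ` S" by blast
      qed
    qed
    moreover have "(`) f ` \<U> \<subseteq> ?C Z"
    proof (rule image_subsetI)
      fix U assume "U \<in> \<U>"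
      then obtain \<beta> where "\<beta> \<in> {ord_of_nat 1..<\<alpha>}" "U \<in> F_Borel Y \<beta>"
        using \<U>(2) by blast
      then show "f ` U \<in> ?C Z" by (intro UN_I[of \<beta>] C) auto
    qed
    moreover have "countable ((`) f ` \<U>)"
      using \<U>(1) by simp
    ultimately have "f ` S \<in> countable_intersections Z (?C Z)"
      unfolding countable_intersections_def mem_Collect_eq by metis
    with 3 show ?thesis by (simp only: F_Borel_odd[OF 3])
  qed
qed


section \<open>Compactifications and absolute classes\<close>

definition tychonoff_space :: "'a topology \<Rightarrow> bool"
  where "tychonoff_space X \<longleftrightarrow> completely_regular_space X \<and> Hausdorff_space X"

definition dense_embedding :: "'a topology \<Rightarrow> 'b topology \<Rightarrow> ('a \<Rightarrow> 'b) \<Rightarrow> bool"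
  where "dense_embedding X Y e \<longleftrightarrow>
    embedding_map X Y e \<and> Y closure_of (e ` topspace X) = topspace Y"

definition compactification :: "'a topology \<Rightarrow> 'b topology \<Rightarrow> ('a \<Rightarrow> 'b) \<Rightarrow> bool"
  where "compactification X K e \<longleftrightarrow>
    compact_space K \<and> Hausdorff_space K \<and> dense_embedding X K e"

text \<open>
  A Hausdorff space with a dense subspace \<open>X\<close> has at most \<open>2 ^ 2 ^ card X\<close> points, so up to
  homeomorphism every such space lives on the type \<open>'a set set\<close>, where \<open>'a\<close> is the type of the
  points of \<open>X\<close>. The two definitions below therefore let the ambient spaces range over topologies on
  \<open>'a set set\<close>; \<open>F_spaceI\<close> and \<open>absolute_F_spaceD\<close> show that they have the intended
  meaning for ambient spaces on arbitrary types.
\<close>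

definition F_space :: "omega1 \<Rightarrow> 'a topology \<Rightarrow> bool"
  where "F_space \<alpha> X \<longleftrightarrow>
    (\<exists>(K :: 'a set set topology) e. compactification X K e \<and> e ` topspace X \<in> F_Borel K \<alpha>)"

definition absolute_F_space :: "omega1 \<Rightarrow> 'a topology \<Rightarrow> bool"
  where "absolute_F_space \<alpha> X \<longleftrightarrow>
    (\<forall>(Y :: 'a set set topology) e.
       tychonoff_space Y \<and> dense_embedding X Y e \<longrightarrow> e ` topspace X \<in> F_Borel Y \<alpha>)"

lemma dense_embedding_subset:
  assumes "dense_embedding X Y e"
  shows "e ` topspace X \<subseteq> topspace Y"
proof -
  have "e ` topspace X = topspace (subtopology Y (e ` topspace X))"
    using assms homeomorphic_imp_surjective_map
    unfolding dense_embedding_def embedding_map_def by blast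
  then show ?thesis by (metis inf_le1 topspace_subtopology)
qed

lemma dense_embedding_homeomorphic_map:
  assumes e: "dense_embedding X Y e" and h: "homeomorphic_map Y Z h"
  shows "dense_embedding X Z (h \<circ> e)"
proof -
  have sub: "e ` topspace X \<subseteq> topspace Y"
    using e by (rule dense_embedding_subset)
  have "embedding_map X Z (h \<circ> e)"
    using e h unfolding dense_embedding_def
    by (meson embedding_map_compose surjective_embedding_map)
  moreover have "Z closure_of ((h \<circ> e) ` topspace X) = topspace Z"
    using e homeomorphic_map_closure_of[OF h sub] homeomorphic_imp_surjective_map[OF h]
    by (simp add: dense_embedding_def image_comp)
  ultimately show ?thesis by (simp add: dense_embedding_def)
qed

lemma dense_embedding_small_copy:
  fixes X :: "'a topology" and Y :: "'b topology"
  assumes e: "dense_embedding X Y e" and Y: "Hausdorff_space Y"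
  obtains Z :: "'a set set topology" and h k
  where "homeomorphic_map Y Z h" "homeomorphic_map Z Y k" "\<And>y. y \<in> topspace Y \<Longrightarrow> k (h y) = y"
proof -
  define h :: "'b \<Rightarrow> 'a set set"
    where "h y = {{x \<in> topspace X. e x \<in> V} |V. openin Y V \<and> y \<in> V}" for y
  have inj: "inj_on h (topspace Y)"
  proof (rule inj_onI, rule ccontr)
    fix y z assume yz: "y \<in> topspace Y" "z \<in> topspace Y" "h y = h z" "y \<noteq> z"
    then obtain U V where UV: "openin Y U" "openin Y V" "y \<in> U" "z \<in> V" "disjnt U V"
      using Y unfolding Hausdorff_space_def by metis
    have "{x \<in> topspace X. e x \<in> U} \<in> h z"
      using UV yz(3) unfolding h_def by blast
    then obtain W where W: "openin Y W" "z \<in> W"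
      "{x \<in> topspace X. e x \<in> U} = {x \<in> topspace X. e x \<in> W}"
      unfolding h_def by blast
    have "z \<in> Y closure_of (e ` topspace X)" "openin Y (W \<inter> V)" "z \<in> W \<inter> V"
      using e yz W UV by (auto simp: dense_embedding_def)
    then obtain x where "x \<in> topspace X" "e x \<in> W \<inter> V"
      unfolding in_closure_of by blast
    then show False using W(3) UV(5) unfolding disjnt_def by blast
  qed
  define k where "k = inv_into (topspace Y) h"
  have kh: "k (h y) = y" if "y \<in> topspace Y" for y
    using inj that by (simp add: k_def)
  define Z where "Z = pullback_topology (h ` topspace Y) k Y"
  have openZ: "openin Z S \<longleftrightarrow> (\<exists>U. openin Y U \<and> S = h ` U)" for S
  proof -
    have "k -` U \<inter> h ` topspace Y = h ` U" if "openin Y U" for U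
      using openin_subset[OF that] by (auto simp: kh subset_iff)
    then show ?thesis unfolding Z_def openin_pullback_topology by metis
  qed
  have topZ: "topspace Z = h ` topspace Y"
    unfolding Z_def topspace_pullback_topology using kh by auto
  have maps: "homeomorphic_maps Y Z h k"
    unfolding homeomorphic_maps_def
  proof (intro conjI ballI)
    have "{y \<in> topspace Y. h y \<in> S} = U" if "openin Y U" "S = h ` U" for S U
      using openin_subset[OF that(1)] that(2) inj_on_image_mem_iff[OF inj] by auto
    then show "continuous_map Y Z h"
      unfolding continuous_map_def topZ openZ by (auto; metis)
    have "{z \<in> topspace Z. k z \<in> U} = h ` U" if "openin Y U" for U
      using openin_subset[OF that] kh by (auto simp: topZ subset_iff)
    then show "continuous_map Z Y k"
      unfolding continuous_map_def openZ using kh by (auto simp: topZ)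
  qed (use kh topZ in auto)
  then show ?thesis
    using that[of Z h k] kh by (simp add: homeomorphic_maps_map)
qed

lemma F_spaceI:
  fixes X :: "'a topology" and K :: "'b topology"
  assumes K: "compactification X K e" and F: "e ` topspace X \<in> F_Borel K \<alpha>"
  shows "F_space \<alpha> X"
proof -
  obtain Z :: "'a set set topology" and h k where hk: "homeomorphic_map K Z h"
    using dense_embedding_small_copy K unfolding compactification_def by metis
  have "K homeomorphic_space Z"
    using hk homeomorphic_space by blast
  then have "compactification X Z (h \<circ> e)"
    using K dense_embedding_homeomorphic_map[OF _ hk]
    by (metis compactification_def homeomorphic_Hausdorff_space homeomorphic_compact_space)
  moreover have "(h \<circ> e) ` topspace X \<in> F_Borel Z \<alpha>"
    using F_Borel_homeomorphic_image[OF hk F] by (simp add: image_comp)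
  ultimately show ?thesis unfolding F_space_def by blast
qed

lemma absolute_F_spaceD:
  fixes X :: "'a topology" and Y :: "'b topology"
  assumes X: "absolute_F_space \<alpha> X" and Y: "tychonoff_space Y" and e: "dense_embedding X Y e"
  shows "e ` topspace X \<in> F_Borel Y \<alpha>"
proof -
  obtain Z :: "'a set set topology" and h k where
    h: "homeomorphic_map Y Z h" and k: "homeomorphic_map Z Y k" and
    kh: "\<And>y. y \<in> topspace Y \<Longrightarrow> k (h y) = y"
    using dense_embedding_small_copy[OF e] Y unfolding tychonoff_space_def by metis
  have "Y homeomorphic_space Z"
    using h homeomorphic_space by blast
  then have "tychonoff_space Z"
    using Y unfolding tychonoff_space_def
    by (metis homeomorphic_Hausdorff_space homeomorphic_completely_regular_space)
  then have "(h \<circ> e) ` topspace X \<in> F_Borel Z \<alpha>"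
    using X dense_embedding_homeomorphic_map[OF e h] unfolding absolute_F_space_def by blast
  then have "k ` (h \<circ> e) ` topspace X \<in> F_Borel Y \<alpha>"
    by (rule F_Borel_homeomorphic_image[OF k])
  moreover have "e ` topspace X \<subseteq> topspace Y"
    using e by (rule dense_embedding_subset)
  then have "k ` (h \<circ> e) ` topspace X = e ` topspace X"
    by (force simp: image_comp kh image_iff)
  ultimately show ?thesis by simp
qed

end

theory Submission
  imports Defs "HOL-Library.Sublist" "HOL-Library.Nat_Bijection"
begin

text \<open>
  The space \<open>T\<close> consists of isolated points, namely the points \<open>d\<close> of the Baire space, and of
  one further point, whose neighbourhoods are the complements of finite unions of members of an
  almost disjoint family \<open>\<E>\<close> and finite sets. A point \<open>d\<close> is regarded as a pair
  \<open>(y, z)\<close>. In a space \<open>Y\<close> containing \<open>T\<close>, each \<open>x\<close> has a tree \<open>S x\<close>, the finite sequences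
  \<open>s\<close> such that \<open>x\<close> is in the closure of \<open>{(y, z). y extends s}\<close>. It has an infinite branch
  if \<open>x \<in> T\<close>, whereas for \<open>x \<notin> T\<close> it lies in the tree of a finite union of members of
  \<open>\<E>\<close>. The condition that \<open>S x\<close> survives the derivative of odd order \<open>\<beta>\<close> is of class \<open>\<F>\<^sub>\<beta>\<close>; so if
  the trees of the members of \<open>\<E>\<close> vanish under the derivative of order \<open>\<alpha> + 1\<close>, then \<open>T\<close> is
  absolutely \<open>\<F>\<close> of class \<open>\<alpha> + 1\<close>. In a compactification that separates the parts
  \<open>{(y, z) \<in> E. y extends s}\<close> of each \<open>E \<in> \<E>\<close>, the trees of the points outside \<open>T\<close> are finite
  chains, so \<open>T\<close> is \<open>F\<^sub>\<sigma>\<^sub>\<delta>\<close> there. In the compactification in which each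
  \<open>E \<in> \<E>\<close> converges to a single point \<open>x\<^sub>E\<close>, a representation of \<open>T\<close> as an \<open>\<F>\<^sub>\<alpha>\<close> set leads,
  by the Baire category theorem, to brooms \<open>E\<close> for which \<open>x\<^sub>E\<close> would have to belong to \<open>T\<close>.
\<close>

section \<open>Parity of countable ordinals\<close>

lemma osuc_le_iff: "osuc \<alpha> \<le> \<beta> \<longleftrightarrow> \<alpha> < \<beta>"
  by (metis less_osuc_iff not_le)

lemma even_ord_osuc: "even_ord (osuc \<beta>) \<longleftrightarrow> \<not> even_ord \<beta>"
proof
  have "odd_ord (osuc \<beta>)" if even: "even_ord \<beta>"
  proof -
    obtain \<gamma> n where "zero_or_limit \<gamma>" "even n" "\<beta> = (osuc ^^ n) \<gamma>"
      using even unfolding even_ord_def by blast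
    then show ?thesis
      unfolding odd_ord_def by (intro exI[of _ \<gamma>] exI[of _ "Suc n"]) simp
  qed
  then show "even_ord (osuc \<beta>) \<Longrightarrow> \<not> even_ord \<beta>"
    unfolding odd_ord_iff_not_even_ord by blast
  assume "\<not> even_ord \<beta>"
  then obtain \<gamma> n where "zero_or_limit \<gamma>" "odd n" "\<beta> = (osuc ^^ n) \<gamma>"
    unfolding odd_ord_iff_not_even_ord[symmetric] odd_ord_def by blast
  then show "even_ord (osuc \<beta>)"
    unfolding even_ord_def by (intro exI[of _ \<gamma>] exI[of _ "Suc n"]) simp
qed

lemma ord_of_nat_Suc: "ord_of_nat (Suc n) = osuc (ord_of_nat n)"
  by (simp add: ord_of_nat_def)

lemma ord_of_nat_0_le: "ord_of_nat 0 \<le> \<beta>"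
  unfolding ord_of_nat_def funpow_0 by (rule Least_le) (rule TrueI)

lemma even_ord_of_nat: "even_ord (ord_of_nat n) \<longleftrightarrow> even n"
proof (induction n)
  case 0
  have "zero_or_limit (ord_of_nat 0)"
    unfolding zero_or_limit_def
  proof
    assume "ord_of_nat 0 \<in> range osuc"
    then obtain \<alpha> where "ord_of_nat 0 = osuc \<alpha>" by blast
    with ord_of_nat_0_le[of \<alpha>] less_osuc[of \<alpha>] show False by simp
  qed
  then have "even_ord (ord_of_nat 0)"
    unfolding even_ord_def by (intro exI[of _ "ord_of_nat 0"] exI[of _ "0::nat"]) simp
  then show ?case by simp
next
  case (Suc n)
  then show ?case by (simp add: ord_of_nat_Suc even_ord_osuc)
qed

lemma one_le_odd_ord:
  assumes "\<not> even_ord \<beta>"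
  shows "ord_of_nat 1 \<le> \<beta>"
proof -
  have "\<beta> \<noteq> ord_of_nat 0"
    using assms even_ord_of_nat[of 0] by auto
  then have "ord_of_nat 0 < \<beta>"
    using ord_of_nat_0_le[of \<beta>] by simp
  then have "osuc (ord_of_nat 0) \<le> \<beta>"
    by (simp only: osuc_le_iff)
  then show ?thesis
    by (simp only: ord_of_nat_Suc One_nat_def)
qed

text \<open>Between two odd ordinals there is always an even one. This leaves room for a countable
  union between two intersections of the hierarchy.\<close>

lemma osuc_less_odd_ord:
  "\<not> even_ord \<gamma> \<Longrightarrow> \<not> even_ord \<beta> \<Longrightarrow> \<gamma> < \<beta> \<Longrightarrow> osuc \<gamma> < \<beta>"
  using even_ord_osuc[of \<gamma>] osuc_le_iff[of \<gamma> \<beta>] by (metis order_le_less)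

section \<open>Derivatives of trees\<close>

text \<open>
  Only the odd ordinals below \<open>\<beta>\<close> take part, because one step of the derivative costs a countable
  union and a countable intersection.
\<close>

function tree_deriv :: "omega1 \<Rightarrow> nat list set \<Rightarrow> nat list set"
  where "tree_deriv \<beta> S =
    {s \<in> S. \<forall>\<gamma>. \<gamma> < \<beta> \<longrightarrow> \<not> even_ord \<gamma> \<longrightarrow> (\<forall>n. \<exists>t\<in>tree_deriv \<gamma> S. prefix s t \<and> n \<le> length t)}"
  by auto
termination
  by (relation "inv_image {(\<beta>, \<alpha>). \<beta> < \<alpha>} fst") (auto simp: wf)

declare tree_deriv.simps [simp del]

lemma tree_deriv_iff:
  "s \<in> tree_deriv \<beta> S \<longleftrightarrow> s \<in> S \<and>
    (\<forall>\<gamma><\<beta>. \<not> even_ord \<gamma> \<longrightarrow> (\<forall>n. \<exists>t\<in>tree_deriv \<gamma> S. prefix s t \<and> n \<le> length t))"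
  by (subst tree_deriv.simps) blast

lemma tree_deriv_subset: "tree_deriv \<beta> S \<subseteq> S"
  by (rule subsetI) (simp only: tree_deriv_iff[of _ \<beta>])

lemma tree_deriv_one: "tree_deriv (ord_of_nat 1) S = S"
  using one_le_odd_ord unfolding set_eq_iff tree_deriv_iff[of _ "ord_of_nat 1"] by (meson leD)

lemma tree_deriv_antimono: "\<gamma> \<le> \<beta> \<Longrightarrow> tree_deriv \<beta> S \<subseteq> tree_deriv \<gamma> S"
  by (rule subsetI) (simp only: tree_deriv_iff[of _ \<beta>] tree_deriv_iff[of _ \<gamma>], meson order_less_le_trans)

text \<open>Whether \<open>s\<close> survives depends only on the extensions of \<open>s\<close>, so
  it suffices to compare the two trees above one node \<open>u\<close>. For a broom this replaces
  the tree of a union by the tree of the one part that lies above \<open>u\<close>.\<close>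

lemma tree_deriv_local_mono:
  assumes "\<And>s. prefix u s \<Longrightarrow> s \<in> S \<Longrightarrow> s \<in> S'" "s \<in> tree_deriv \<beta> S" "prefix u s"
  shows "s \<in> tree_deriv \<beta> S'"
  using assms(2,3)
proof (induction \<beta> arbitrary: s rule: less_induct)
  case (less \<beta>)
  have "\<exists>t\<in>tree_deriv \<gamma> S'. prefix s t \<and> n \<le> length t" if \<gamma>: "\<gamma> < \<beta>" "\<not> even_ord \<gamma>" for \<gamma> n
  proof -
    obtain t where "t \<in> tree_deriv \<gamma> S" "prefix s t" "n \<le> length t"
      using less.prems(1) \<gamma> unfolding tree_deriv_iff[of s \<beta>] by blast
    then show ?thesis
      using less.IH[OF \<gamma>(1), of t] less.prems(2) by (meson prefix_order.order_trans)
  qed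
  moreover have "s \<in> S'"
    using less.prems assms(1)[of s] tree_deriv_subset by blast
  ultimately show ?case unfolding tree_deriv_iff[of s \<beta>] by blast
qed

lemma tree_deriv_mono: "S \<subseteq> S' \<Longrightarrow> tree_deriv \<beta> S \<subseteq> tree_deriv \<beta> S'"
  by (rule subsetI, rule tree_deriv_local_mono[of "[]" S S']) auto

definition prefix_closed :: "nat list set \<Rightarrow> bool"
  where "prefix_closed S \<longleftrightarrow> (\<forall>s t. t \<in> S \<longrightarrow> prefix s t \<longrightarrow> s \<in> S)"

text \<open>If \<open>s\<close> is in both trees and lost from both derivatives, each loss is
  witnessed by an odd order below \<open>\<beta>\<close> and a length bound. The larger order and
  the larger bound contradict the survival of \<open>s\<close> in the union, by the induction
  hypothesis at that larger order.\<close>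

lemma tree_deriv_Un_subset:
  assumes "prefix_closed S" "prefix_closed S'"
  shows "tree_deriv \<beta> (S \<union> S') \<subseteq> tree_deriv \<beta> S \<union> tree_deriv \<beta> S'"
proof (induction \<beta> rule: less_induct)
  case (less \<beta>)
  \<comment> \<open>The second alternative is the case that \<open>s\<close> is not in the tree at
    all; prefix-closedness then excludes all its extensions.\<close>
  have bound: "(\<exists>\<gamma> n. \<gamma> < \<beta> \<and> \<not> even_ord \<gamma> \<and> (\<forall>t\<in>tree_deriv \<gamma> R. prefix s t \<longrightarrow> length t < n)) \<or>
      (\<forall>t\<in>R. \<not> prefix s t)"
    if "s \<notin> tree_deriv \<beta> R" "prefix_closed R" for s R
    using that unfolding tree_deriv_iff[of s \<beta>] prefix_closed_def not_le[symmetric] by blast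
  show ?case
  proof (rule subsetI, rule ccontr)
    fix s assume s: "s \<in> tree_deriv \<beta> (S \<union> S')" and ns: "s \<notin> tree_deriv \<beta> S \<union> tree_deriv \<beta> S'"
    have long: "\<exists>t\<in>tree_deriv \<gamma> S \<union> tree_deriv \<gamma> S'. prefix s t \<and> n \<le> length t"
      if "\<gamma> < \<beta>" "\<not> even_ord \<gamma>" for \<gamma> n
      using s that less.IH[OF that(1)] unfolding tree_deriv_iff[of s \<beta>] by blast
    have "s \<in> S \<union> S'" using s tree_deriv_subset by blast
    then consider (both) \<gamma> n \<gamma>' n' where "\<gamma> < \<beta>" "\<not> even_ord \<gamma>"
          "\<forall>t\<in>tree_deriv \<gamma> S. prefix s t \<longrightarrow> length t < n" "\<gamma>' < \<beta>" "\<not> even_ord \<gamma>'"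
          "\<forall>t\<in>tree_deriv \<gamma>' S'. prefix s t \<longrightarrow> length t < n'"
      | (left) \<gamma> n where "\<gamma> < \<beta>" "\<not> even_ord \<gamma>"
          "\<forall>t\<in>tree_deriv \<gamma> S. prefix s t \<longrightarrow> length t < n" "\<forall>t\<in>S'. \<not> prefix s t"
      | (right) \<gamma> n where "\<gamma> < \<beta>" "\<not> even_ord \<gamma>"
          "\<forall>t\<in>tree_deriv \<gamma> S'. prefix s t \<longrightarrow> length t < n" "\<forall>t\<in>S. \<not> prefix s t"
      using bound[of s S] bound[of s S'] ns assms by blast
    then show False
    proof cases
      case both
      have "max \<gamma> \<gamma>' < \<beta>" "\<not> even_ord (max \<gamma> \<gamma>')" using both by (auto simp: max_def)
      from long[OF this, of "max n n'"] obtain t where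
        t: "t \<in> tree_deriv (max \<gamma> \<gamma>') S \<union> tree_deriv (max \<gamma> \<gamma>') S'" "prefix s t" "max n n' \<le> length t"
        by blast
      moreover have "tree_deriv (max \<gamma> \<gamma>') S \<subseteq> tree_deriv \<gamma> S" "tree_deriv (max \<gamma> \<gamma>') S' \<subseteq> tree_deriv \<gamma>' S'"
        by (auto intro!: tree_deriv_antimono)
      ultimately show ?thesis using both(3,6) by (meson Un_iff leD max.boundedE subsetD)
    next
      case left
      then show ?thesis using long[of \<gamma> n] tree_deriv_subset[of \<gamma> S'] by (meson Un_iff leD subsetD)
    next
      case right
      then show ?thesis using long[of \<gamma> n] tree_deriv_subset[of \<gamma> S] by (meson Un_iff leD subsetD)
    qed
  qed
qed

text \<open>Longer initial segments of the same branch witness every stage, so no derivative removes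
  an infinite branch. This keeps the roots of the trees of points of the space, and it shows that a
  tree with vanishing derivative has no branch.\<close>

lemma branch_in_tree_deriv:
  fixes y :: "nat \<Rightarrow> nat"
  assumes "\<And>n. map y [0..<n] \<in> S"
  shows "map y [0..<n] \<in> tree_deriv \<beta> S"
proof (induction \<beta> arbitrary: n rule: less_induct)
  case (less \<beta>)
  have "\<exists>t\<in>tree_deriv \<gamma> S. prefix (map y [0..<n]) t \<and> m \<le> length t" if "\<gamma> < \<beta>" for \<gamma> m
  proof (intro bexI conjI)
    have "[0..<n + m] = [0..<n] @ [n..<n + m]" by (metis le0 upt_add_eq_append)
    then show "prefix (map y [0..<n]) (map y [0..<n + m])" by simp
  qed (use less.IH[OF that] in auto)
  then show ?case using assms unfolding tree_deriv_iff[of _ \<beta>] by blast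
qed

text \<open>Unfolding the derivative once turns survival into a countable intersection, over odd
  \<open>\<gamma> < \<beta>\<close> and over \<open>n\<close>, of countable unions, over lists
  \<open>t\<close>, of sets of class \<open>\<gamma>\<close>. The unions have class
  \<open>osuc \<gamma>\<close>, which is still below the odd ordinal \<open>\<beta>\<close>.\<close>

lemma F_Borel_tree_deriv:
  assumes C: "\<And>s. closedin Y (C s)" and "\<not> even_ord \<beta>"
  shows "{x \<in> topspace Y. s \<in> tree_deriv \<beta> {s. x \<in> C s}} \<in> F_Borel Y \<beta>"
  using assms(2)
proof (induction \<beta> arbitrary: s rule: less_induct)
  case (less \<beta>)
  define W where "W \<gamma> s = {x \<in> topspace Y. s \<in> tree_deriv \<gamma> {s. x \<in> C s}}" for \<gamma> s
  have C_sub: "C s \<subseteq> topspace Y" for s using C closedin_subset by blast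
  have one: "ord_of_nat 1 \<le> \<beta>" using less.prems by (rule one_le_odd_ord)
  show ?case
  proof (cases "\<beta> \<le> ord_of_nat 1")
    case True
    with one have "\<beta> = ord_of_nat 1" by simp
    moreover have "{x \<in> topspace Y. x \<in> C s} = C s" using C_sub by blast
    ultimately show ?thesis using C[of s] by (simp add: tree_deriv_one F_Borel_first del: One_nat_def)
  next
    case False
    define V where "V \<gamma> n = \<Union>(W \<gamma> ` {t. prefix s t \<and> n \<le> length t})" for \<gamma> and n :: nat
    define G where "G = {\<gamma>. \<gamma> < \<beta> \<and> \<not> even_ord \<gamma>}"
    have V: "V \<gamma> n \<in> F_Borel Y (osuc \<gamma>)" if "\<gamma> \<in> G" for \<gamma> n
    proof -
      have "W \<gamma> t \<in> F_Borel Y \<gamma>" for t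
        using that less.IH[of \<gamma>] unfolding W_def G_def by blast
      moreover have \<gamma>: "ord_of_nat 1 \<le> \<gamma>" "even_ord (osuc \<gamma>)"
        using that one_le_odd_ord[of \<gamma>] unfolding G_def even_ord_osuc mem_Collect_eq by blast+
      ultimately have "V \<gamma> n \<in> countable_unions (\<Union>\<delta>\<in>{ord_of_nat 1..<osuc \<gamma>}. F_Borel Y \<delta>)"
        unfolding countable_unions_def V_def
        using less_osuc[of \<gamma>]
        by (intro CollectI exI[of _ "W \<gamma> ` {t. prefix s t \<and> n \<le> length t}"] conjI image_subsetI
              UN_I[of \<gamma>]) (simp_all del: One_nat_def)
      moreover have "\<not> osuc \<gamma> \<le> ord_of_nat 1" using \<gamma>(1) by (simp only: osuc_le_iff not_less)
      from F_Borel_even[OF this \<gamma>(2), of Y] have "F_Borel Y (osuc \<gamma>) =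
          countable_unions (\<Union>\<delta>\<in>{ord_of_nat 1..<osuc \<gamma>}. F_Borel Y \<delta>)" .
      ultimately show ?thesis by (simp only:)
    qed
    define \<U> where "\<U> = insert (C s) ((\<lambda>(\<gamma>, n). V \<gamma> n) ` (G \<times> UNIV))"
    have "W \<beta> s = topspace Y \<inter> \<Inter>\<U>"
      unfolding \<U>_def W_def V_def tree_deriv_iff[of s \<beta>] G_def by (rule set_eqI) (simp, blast)
    moreover have "countable \<U>"
    proof -
      have "G \<subseteq> {..<\<beta>}" by (auto simp: G_def)
      then show ?thesis
        unfolding \<U>_def
        by (intro countable_insert countable_image countable_SIGMA
            countable_subset[OF _ countable_below[of \<beta>]]) auto
    qed
    moreover have "\<U> \<subseteq> (\<Union>\<delta>\<in>{ord_of_nat 1..<\<beta>}. F_Borel Y \<delta>)"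
    proof -
      have "C s \<in> F_Borel Y (ord_of_nat 1)" using C[of s] by (simp add: F_Borel_first del: One_nat_def)
      then have "C s \<in> (\<Union>\<delta>\<in>{ord_of_nat 1..<\<beta>}. F_Borel Y \<delta>)"
        using False by (intro UN_I[of "ord_of_nat 1"]) (simp_all del: One_nat_def)
      moreover have "osuc \<gamma> \<in> {ord_of_nat 1..<\<beta>}" if "\<gamma> \<in> G" for \<gamma>
        using that osuc_less_odd_ord[OF _ less.prems, of \<gamma>] one_le_odd_ord[of \<gamma>] less_osuc[of \<gamma>]
        unfolding G_def atLeastLessThan_iff mem_Collect_eq by (meson le_less_trans less_imp_le)
      then have "V \<gamma> n \<in> (\<Union>\<delta>\<in>{ord_of_nat 1..<\<beta>}. F_Borel Y \<delta>)" if "\<gamma> \<in> G" for \<gamma> n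
        using V[OF that] that by (rule_tac UN_I)
      ultimately show ?thesis
        unfolding \<U>_def by auto
    qed
    ultimately have "W \<beta> s \<in> countable_intersections Y (\<Union>\<delta>\<in>{ord_of_nat 1..<\<beta>}. F_Borel Y \<delta>)"
      unfolding countable_intersections_def by (intro CollectI exI[of _ \<U>] conjI)
    then show ?thesis unfolding F_Borel_odd[OF False less.prems] W_def .
  qed
qed

section \<open>Category in the Baire space\<close>

definition cyl :: "nat list \<Rightarrow> (nat \<Rightarrow> nat) set"
  where "cyl s = {y. map y [0..<length s] = s}"

lemma cyl_Nil [simp]: "cyl [] = UNIV"
  by (simp add: cyl_def)

lemma cyl_prefix_eq: "y \<in> cyl s \<Longrightarrow> n \<le> length s \<Longrightarrow> map y [0..<n] = take n s"
  unfolding cyl_def mem_Collect_eq by (metis add_0 take_map take_upt)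

lemma cyl_mono: "prefix s t \<Longrightarrow> cyl t \<subseteq> cyl s"
  using cyl_prefix_eq[of _ t "length s"] by (auto simp: cyl_def prefix_def)

lemma cyl_same_length:
  assumes "y \<in> cyl s" "y \<in> cyl t" "length s \<le> length t"
  shows "prefix s t"
proof -
  have "s = take (length s) t"
    using cyl_prefix_eq[OF assms(2,3)] assms(1) by (simp add: cyl_def)
  then show ?thesis by (metis take_is_prefix)
qed

lemma map_in_cyl: "y \<in> cyl (map y [0..<n])"
  by (simp add: cyl_def)

definition nowhere_dense :: "(nat \<Rightarrow> nat) set \<Rightarrow> bool"
  where "nowhere_dense A \<longleftrightarrow> (\<forall>s. \<exists>t. prefix s t \<and> A \<inter> cyl t = {})"

definition meager :: "(nat \<Rightarrow> nat) set \<Rightarrow> bool"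
  where "meager A \<longleftrightarrow> (\<exists>F :: nat \<Rightarrow> _. (\<forall>n. nowhere_dense (F n)) \<and> A \<subseteq> (\<Union>n. F n))"

lemma meager_subset: "meager B \<Longrightarrow> A \<subseteq> B \<Longrightarrow> meager A"
  unfolding meager_def by (meson subset_trans)

lemma nowhere_dense_imp_meager: "nowhere_dense A \<Longrightarrow> meager A"
  unfolding meager_def by (intro exI[of _ "\<lambda>_. A"]) auto

lemma meager_empty: "meager {}"
  by (rule nowhere_dense_imp_meager) (auto simp: nowhere_dense_def)

lemma meager_UN_nat:
  assumes "\<And>n::nat. meager (A n)"
  shows "meager (\<Union>n. A n)"
proof -
  obtain F :: "nat \<Rightarrow> nat \<Rightarrow> _" where
    F: "\<And>n k. nowhere_dense (F n k)" "\<And>n. A n \<subseteq> (\<Union>k. F n k)"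
    using assms unfolding meager_def by metis
  have "(\<Union>n. A n) \<subseteq> (\<Union>m. case prod_decode m of (n, k) \<Rightarrow> F n k)"
  proof
    fix x assume "x \<in> (\<Union>n. A n)"
    then obtain n k where "x \<in> F n k" using F(2) by blast
    then show "x \<in> (\<Union>m. case prod_decode m of (n, k) \<Rightarrow> F n k)"
      by (intro UN_I[of "prod_encode (n, k)"]) auto
  qed
  moreover have "nowhere_dense (case prod_decode m of (n, k) \<Rightarrow> F n k)" for m
    using F(1) by (simp split: prod.split)
  ultimately show ?thesis
    unfolding meager_def by (intro exI[of _ "\<lambda>m. case prod_decode m of (n, k) \<Rightarrow> F n k"]) simp
qed

lemma meager_UN_list:
  assumes "\<And>s :: nat list. meager (A s)"
  shows "meager (\<Union>s. A s)"
proof -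
  have "(\<Union>s. A s) \<subseteq> (\<Union>n. A (list_decode n))"
    by (metis UN_least UN_upper UNIV_I list_encode_inverse)
  with meager_UN_nat[of "\<lambda>n. A (list_decode n)"] assms show ?thesis
    using meager_subset by blast
qed

text \<open>The Baire category theorem: extend \<open>h\<close> so as to avoid \<open>F 0\<close>,
  \<open>F 1\<close>, ... in turn, and take the limit of the extensions.\<close>

lemma not_meager_cyl: "\<not> meager (cyl h)"
proof
  assume "meager (cyl h)"
  then obtain F :: "nat \<Rightarrow> _" where F: "\<And>n. nowhere_dense (F n)" "cyl h \<subseteq> (\<Union>n. F n)"
    unfolding meager_def by blast
  have "\<exists>f. \<forall>n s. prefix s (f n s) \<and> F n \<inter> cyl (f n s) = {}"
    using F(1) unfolding nowhere_dense_def by metis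
  then obtain f where f: "\<And>n s. prefix s (f n s)" "\<And>n s. F n \<inter> cyl (f n s) = {}" by blast
  \<comment> \<open>The appended \<open>0\<close> makes the lengths grow without bound, so that the
    nodes determine a single point.\<close>
  define s where "s = rec_nat h (\<lambda>n t. f n t @ [0])"
  have s0: "s 0 = h" and sS: "s (Suc n) = f n (s n) @ [0]" for n
    by (simp_all add: s_def)
  have step: "prefix (f n (s n)) (s (Suc n))" "prefix (s n) (s (Suc n))" for n
    using f(1)[of "s n" n] by (auto simp: sS)
  have mono: "prefix (s m) (s n)" if "m \<le> n" for m n
    using that by (induction rule: dec_induct) (auto intro: prefix_order.order_trans step)
  have len: "n \<le> length (s n)" for n
  proof (induction n)
    case (Suc n)
    then show ?case using prefix_length_le[OF f(1)[of "s n" n]] by (simp add: sS)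
  qed simp
  define y where "y i = s (Suc i) ! i" for i
  have nth: "s n ! i = y i" if "i < length (s n)" for n i
  proof -
    have "i < length (s (Suc i))" using len[of "Suc i"] by simp
    moreover have "prefix (s n) (s (Suc i)) \<or> prefix (s (Suc i)) (s n)"
      using mono[of n "Suc i"] mono[of "Suc i" n] by linarith
    ultimately show ?thesis using that unfolding y_def prefix_def by (auto simp: nth_append)
  qed
  have y: "y \<in> cyl (s n)" for n
    unfolding cyl_def by (auto intro!: nth_equalityI simp: nth)
  then have "y \<in> cyl h" using s0 by metis
  then obtain n where "y \<in> F n" using F(2) by blast
  moreover have "y \<in> cyl (f n (s n))" using y[of "Suc n"] cyl_mono[OF step(1)] by blast
  ultimately show False using f(2) by blast
qed

text \<open>Largeness in every cylinder inside \<open>cyl h\<close> is inherited by longer stems; a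
  broom may therefore start a new part above each \<open>h @ [n]\<close>.\<close>

definition nonmeager_above :: "nat list \<Rightarrow> (nat \<Rightarrow> nat) set \<Rightarrow> bool"
  where "nonmeager_above h A \<longleftrightarrow> (\<forall>s. prefix h s \<longrightarrow> \<not> meager (A \<inter> cyl s))"

lemma nonmeager_above_mono:
  "nonmeager_above h A \<Longrightarrow> A \<subseteq> B \<Longrightarrow> prefix h h' \<Longrightarrow> nonmeager_above h' B"
  unfolding nonmeager_above_def
  by (meson Int_mono meager_subset order_refl prefix_order.order_trans)

lemma nonmeager_above_nonempty: "nonmeager_above h A \<Longrightarrow> prefix h s \<Longrightarrow> A \<inter> cyl s \<noteq> {}"
  unfolding nonmeager_above_def
  using meager_empty by metis

text \<open>Otherwise every extension of \<open>h\<close> has a further extension \<open>t\<close>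
  with \<open>A \<inter> cyl t\<close> meager. There are only countably many such traces, so their
  union is meager, and what remains of \<open>A \<inter> cyl h\<close> is nowhere dense.\<close>

lemma nonmeager_above_localize:
  assumes "\<not> meager (A \<inter> cyl h)"
  shows "\<exists>h'. prefix h h' \<and> nonmeager_above h' A"
proof (rule ccontr)
  assume "\<nexists>h'. prefix h h' \<and> nonmeager_above h' A"
  then have none: "\<not> nonmeager_above h' A" if "prefix h h'" for h' using that by blast
  define B where "B s = (if meager (A \<inter> cyl s) then A \<inter> cyl s else {})" for s
  have "meager (\<Union>s. B s)"
    by (rule meager_UN_list) (auto simp: B_def meager_empty)
  moreover have "nowhere_dense (A \<inter> cyl h - (\<Union>s. B s))"
    unfolding nowhere_dense_def
  proof
    fix s
    show "\<exists>t. prefix s t \<and> (A \<inter> cyl h - (\<Union>s. B s)) \<inter> cyl t = {}"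
    proof (cases "prefix h s \<or> prefix s h")
      case True
      then obtain u where u: "prefix s u" "prefix h u" by blast
      then obtain t where t: "prefix u t" "meager (A \<inter> cyl t)"
        using none unfolding nonmeager_above_def by blast
      then have "A \<inter> cyl t \<subseteq> (\<Union>s. B s)" unfolding B_def by fastforce
      moreover have "prefix s t" using u t by (meson prefix_order.order_trans)
      ultimately show ?thesis by blast
    next
      case False
      then have "cyl h \<inter> cyl s = {}" using cyl_same_length[of _ h s] cyl_same_length[of _ s h] nat_le_linear[of "length h" "length s"] by blast
      then show ?thesis by blast
    qed
  qed
  ultimately have "meager (\<Union>n::nat. if n = 0 then (\<Union>s. B s) else A \<inter> cyl h - (\<Union>s. B s))"
    by (intro meager_UN_nat) (simp add: nowhere_dense_imp_meager)
  moreover have "A \<inter> cyl h \<subseteq> (\<Union>n::nat. if n = 0 then (\<Union>s. B s) else A \<inter> cyl h - (\<Union>s. B s))"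
  proof
    fix x assume "x \<in> A \<inter> cyl h"
    then show "x \<in> (\<Union>n::nat. if n = 0 then (\<Union>s. B s) else A \<inter> cyl h - (\<Union>s. B s))"
      by (cases "x \<in> (\<Union>s. B s)") (auto intro: UN_I[of 0] UN_I[of 1])
  qed
  ultimately show False using assms meager_subset by blast
qed

text \<open>A pigeonhole principle for category; it selects the member of a union in which a broom
  is continued.\<close>

lemma nonmeager_above_UN:
  assumes "nonmeager_above h A" "A \<subseteq> (\<Union>n::nat. B n)"
  obtains n h' where "prefix h h'" "nonmeager_above h' (B n)"
proof -
  have "\<exists>n. \<not> meager (B n \<inter> cyl h)"
  proof (rule ccontr)
    assume "\<nexists>n. \<not> meager (B n \<inter> cyl h)"
    then have "meager (\<Union>n. B n \<inter> cyl h)" by (intro meager_UN_nat) blast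
    moreover have "A \<inter> cyl h \<subseteq> (\<Union>n. B n \<inter> cyl h)" using assms(2) by blast
    ultimately show False
      using assms(1) meager_subset unfolding nonmeager_above_def by blast
  qed
  then show ?thesis using nonmeager_above_localize that by blast
qed

section \<open>Brooms\<close>

definition ycoord :: "(nat \<Rightarrow> nat) \<Rightarrow> nat \<Rightarrow> nat"
  where "ycoord d n = d (2 * n)"

definition zcoord :: "(nat \<Rightarrow> nat) \<Rightarrow> nat \<Rightarrow> nat"
  where "zcoord d n = d (2 * n + 1)"

definition merge :: "(nat \<Rightarrow> nat) \<Rightarrow> (nat \<Rightarrow> nat) \<Rightarrow> nat \<Rightarrow> nat"
  where "merge y z i = (if even i then y (i div 2) else z (i div 2))"

lemma ycoord_merge [simp]: "ycoord (merge y z) = y"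
  and zcoord_merge [simp]: "zcoord (merge y z) = z"
  by (auto simp: ycoord_def zcoord_def merge_def)

definition ycyl :: "nat list \<Rightarrow> (nat \<Rightarrow> nat) set"
  where "ycyl s = ycoord -` cyl s"

definition znear :: "(nat \<Rightarrow> nat) \<Rightarrow> nat \<Rightarrow> (nat \<Rightarrow> nat) set"
  where "znear z k = {d. \<forall>i<k. zcoord d i = z i}"

lemma ycyl_mono: "prefix s t \<Longrightarrow> ycyl t \<subseteq> ycyl s"
  unfolding ycyl_def by (rule vimage_mono) (rule cyl_mono)

lemma ycyl_comparable:
  assumes "d \<in> ycyl s" "d \<in> ycyl t"
  shows "prefix s t \<or> prefix t s"
  using assms cyl_same_length[of "ycoord d" s t] cyl_same_length[of "ycoord d" t s]
    nat_le_linear[of "length s" "length t"]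
  unfolding ycyl_def by blast

lemma znear_mono: "k \<le> m \<Longrightarrow> znear z m \<subseteq> znear z k"
  by (auto simp: znear_def)

text \<open>Finite sets being closed, a point outside the space can lie in the closure of the part
  of \<open>E\<close> over \<open>s\<close> only if that part is infinite. So these trees bound the
  trees of remainder points.\<close>

definition inf_tree :: "(nat \<Rightarrow> nat) set \<Rightarrow> nat list set"
  where "inf_tree E = {s. infinite (E \<inter> ycyl s)}"

lemma prefix_closed_inf_tree: "prefix_closed (inf_tree E)"
  unfolding prefix_closed_def inf_tree_def
proof (clarify)
  fix s t assume "prefix s t" "finite (E \<inter> ycyl s)" and "infinite (E \<inter> ycyl t)"
  moreover from \<open>prefix s t\<close> have "E \<inter> ycyl t \<subseteq> E \<inter> ycyl s" using ycyl_mono by blast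
  ultimately show False using finite_subset by blast
qed

lemma inf_tree_Un: "inf_tree (E \<union> E') = inf_tree E \<union> inf_tree E'"
  by (auto simp: inf_tree_def Int_Un_distrib2)

lemma inf_tree_finite: "finite E \<Longrightarrow> inf_tree E = {}"
  by (simp add: inf_tree_def)

lemma Nil_notin_tree_deriv_inf_tree_Union:
  assumes "finite \<F>" "\<And>E. E \<in> \<F> \<Longrightarrow> [] \<notin> tree_deriv \<beta> (inf_tree E)"
  shows "[] \<notin> tree_deriv \<beta> (inf_tree (\<Union>\<F>))"
  using assms
proof (induction rule: finite_induct)
  case empty
  then show ?case using tree_deriv_subset[of \<beta> "inf_tree {}"] by (auto simp: inf_tree_finite)
next
  case (insert E \<F>)
  then show ?case
    using tree_deriv_Un_subset[OF prefix_closed_inf_tree prefix_closed_inf_tree, of \<beta> E "\<Union>\<F>"]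
    unfolding Union_insert inf_tree_Un by blast
qed

section \<open>Codes for F-Borel sets and their parametrization\<close>

text \<open>
  A code describes how a set is built from closed sets by countable unions and intersections. Of a
  closed set it records only a countable subset, dense in the trace of the closed set for the
  product topology of the two coordinates.
\<close>

datatype fcode = Leaf "(nat \<Rightarrow> nat) set" | Join "nat \<Rightarrow> fcode" | Meet "nat \<Rightarrow> fcode"

inductive of_class :: "omega1 \<Rightarrow> fcode \<Rightarrow> bool"
  where
    of_class_Leaf: "ord_of_nat 1 \<le> \<beta> \<Longrightarrow> countable A \<Longrightarrow> of_class \<beta> (Leaf A)"
  | of_class_Join: "even_ord \<beta> \<Longrightarrow> (\<And>n. \<exists>\<gamma><\<beta>. of_class \<gamma> (f n)) \<Longrightarrow> of_class \<beta> (Join f)"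
  | of_class_Meet: "\<not> even_ord \<beta> \<Longrightarrow> (\<And>n. \<exists>\<gamma><\<beta>. of_class \<gamma> (f n)) \<Longrightarrow> of_class \<beta> (Meet f)"

inductive_cases of_class_LeafE: "of_class \<beta> (Leaf A)"
inductive_cases of_class_JoinE: "of_class \<beta> (Join f)"
inductive_cases of_class_MeetE: "of_class \<beta> (Meet f)"

text \<open>One code may encode many sets: a leaf keeps only enough points to meet every box
  \<open>ycyl s \<inter> znear z k\<close> that the closed set meets. This is all that a broom
  needs, and it leaves few enough codes to be named by sequences.\<close>

inductive encodes :: "'b topology \<Rightarrow> ((nat \<Rightarrow> nat) \<Rightarrow> 'b) \<Rightarrow> fcode \<Rightarrow> 'b set \<Rightarrow> bool"
  for Y e
  where
    encodes_Leaf: "closedin Y X \<Longrightarrow> A \<subseteq> e -` X \<Longrightarrow>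
      (\<And>d s z k. d \<in> e -` X \<Longrightarrow> d \<in> ycyl s \<Longrightarrow> d \<in> znear z k \<Longrightarrow> A \<inter> ycyl s \<inter> znear z k \<noteq> {}) \<Longrightarrow>
      encodes Y e (Leaf A) X"
  | encodes_Join: "(\<And>n. encodes Y e (f n) (X n)) \<Longrightarrow> encodes Y e (Join f) (\<Union>n. X n)"
  | encodes_Meet: "(\<And>n. encodes Y e (f n) (X n)) \<Longrightarrow> encodes Y e (Meet f) (\<Inter>n. X n)"

inductive_cases encodes_LeafE: "encodes Y e (Leaf A) X"
inductive_cases encodes_JoinE: "encodes Y e (Join f) X"
inductive_cases encodes_MeetE: "encodes Y e (Meet f) X"

text \<open>There are only countably many boxes given by finite sequences \<open>s\<close> and
  \<open>r\<close>; one point is chosen from each box that the closed set meets.\<close>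

lemma closed_encodable:
  assumes "closedin Y X"
  obtains A where "countable A" "encodes Y e (Leaf A) X"
proof -
  define pick where "pick s r = (SOME d. d \<in> e -` X \<inter> ycyl s \<inter> zcoord -` cyl r)" for s r
  define A where "A = (\<lambda>(s, r). pick s r) ` UNIV \<inter> e -` X"
  have "countable A" unfolding A_def by (intro countable_Int1) simp
  moreover have "A \<inter> ycyl s \<inter> znear z k \<noteq> {}"
    if "d \<in> e -` X" "d \<in> ycyl s" "d \<in> znear z k" for d s z k
  proof -
    define r where "r = map z [0..<k]"
    have r: "zcoord d' \<in> cyl r \<longleftrightarrow> d' \<in> znear z k" for d'
      unfolding r_def cyl_def znear_def by auto
    then have "d \<in> e -` X \<inter> ycyl s \<inter> zcoord -` cyl r" using that by simp
    then have "pick s r \<in> e -` X \<inter> ycyl s \<inter> zcoord -` cyl r"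
      unfolding pick_def by (rule someI[of "\<lambda>d. d \<in> e -` X \<inter> ycyl s \<inter> zcoord -` cyl r"])
    moreover from this have "pick s r \<in> A" unfolding A_def by auto
    ultimately show ?thesis using r by blast
  qed
  ultimately show ?thesis
    using that[of A] encodes_Leaf[OF assms, of A e] unfolding A_def by blast
qed

lemma F_Borel_encodable:
  assumes "X \<in> F_Borel Y \<beta>" "ord_of_nat 1 \<le> \<beta>"
  shows "\<exists>t. of_class \<beta> t \<and> encodes Y e t X"
  using assms
proof (induction \<beta> arbitrary: X rule: less_induct)
  case (less \<beta>)
  define C where "C = (\<Union>\<gamma>\<in>{ord_of_nat 1..<\<beta>}. F_Borel Y \<gamma>)"
  have IH: "\<exists>t. (\<exists>\<gamma><\<beta>. of_class \<gamma> t) \<and> encodes Y e t U" if "U \<in> C" for U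
  proof -
    from that show ?thesis
      unfolding C_def
    proof (elim UN_E)
      fix \<gamma> assume "\<gamma> \<in> {ord_of_nat 1..<\<beta>}" "U \<in> F_Borel Y \<gamma>"
      then show ?thesis
        using less.IH[of \<gamma> U] unfolding atLeastLessThan_iff by metis
    qed
  qed
  have closed: "\<exists>t. of_class \<beta> t \<and> encodes Y e t X" if X: "closedin Y X"
  proof -
    obtain A where "countable A" "encodes Y e (Leaf A) X" using closed_encodable[OF X] .
    then show ?thesis using of_class_Leaf less.prems(2) by blast
  qed
  show ?case
  proof (cases "\<beta> \<le> ord_of_nat 1")
    case True
    then show ?thesis using closed less.prems(1) by (simp only: F_Borel_first[OF True] mem_Collect_eq)
  next
    case False
    have codes: "\<exists>f. (\<forall>n. \<exists>\<gamma><\<beta>. of_class \<gamma> (f n)) \<and>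
        (\<forall>n. encodes Y e (f n) (from_nat_into \<U> n))"
      if "\<U> \<subseteq> C" "\<U> \<noteq> {}" for \<U>
    proof -
      have "\<forall>n. \<exists>t. (\<exists>\<gamma><\<beta>. of_class \<gamma> t) \<and> encodes Y e t (from_nat_into \<U> n)"
        by (rule allI, rule IH, rule subsetD[OF that(1)], rule from_nat_into[OF that(2)])
      from choice[OF this] show ?thesis by (simp only: all_conj_distrib)
    qed
    show ?thesis
    proof (cases "even_ord \<beta>")
      case True
      have "X \<in> countable_unions C"
        using less.prems(1) unfolding F_Borel_even[OF False True] C_def .
      then obtain \<U> where \<U>: "countable \<U>" "\<U> \<subseteq> C" "X = \<Union>\<U>"
        unfolding countable_unions_def by blast
      show ?thesis
      proof (cases "\<U> = {}")
        case True
        then show ?thesis using closed \<U>(3) by simp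
      next
        case nonempty: False
        then obtain f where f: "\<And>n. \<exists>\<gamma><\<beta>. of_class \<gamma> (f n)"
          "\<And>n. encodes Y e (f n) (from_nat_into \<U> n)"
          using codes[OF \<U>(2)] by blast
        have "X = (\<Union>n. from_nat_into \<U> n)"
          using \<U>(1,3) nonempty by (simp add: range_from_nat_into)
        then have "encodes Y e (Join f) X"
          by (simp only: encodes_Join[OF f(2)])
        with of_class_Join[OF True f(1)] show ?thesis by (intro exI conjI)
      qed
    next
      case odd: False
      have "X \<in> countable_intersections Y C"
        using less.prems(1) unfolding F_Borel_odd[OF False odd] C_def .
      then obtain \<U> where \<U>: "countable \<U>" "\<U> \<subseteq> C" "X = topspace Y \<inter> \<Inter>\<U>"
        unfolding countable_intersections_def by blast
      show ?thesis
      proof (cases "\<U> = {}")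
        case True
        then show ?thesis using closed \<U>(3) by simp
      next
        case nonempty: False
        then obtain f where f: "\<And>n. \<exists>\<gamma><\<beta>. of_class \<gamma> (f n)"
          "\<And>n. encodes Y e (f n) (from_nat_into \<U> n)"
          using codes[OF \<U>(2)] by blast
        have "U \<subseteq> topspace Y" if "U \<in> \<U>" for U
        proof -
          from that \<U>(2) have "U \<in> C" by (rule subsetD[rotated])
          then show ?thesis unfolding C_def by (elim UN_E F_Borel_subset)
        qed
        then have "X = \<Inter>\<U>" using \<U>(3) nonempty by blast
        then have "X = (\<Inter>n. from_nat_into \<U> n)"
          using \<U>(1) nonempty by (simp add: range_from_nat_into)
        then have "encodes Y e (Meet f) X"
          by (simp only: encodes_Meet[OF f(2)])
        with of_class_Meet[OF odd f(1)] show ?thesis by (intro exI conjI)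
      qed
    qed
  qed
qed

text \<open>A code of class \<open>\<beta>\<close> has countably many children, each from one of the
  countably many classes below \<open>\<beta>\<close>. One sequence can store the kind of the node
  and, for each \<open>n\<close>, the index of a smaller class together with a parameter of the
  \<open>n\<close>-th child.\<close>

lemma of_class_parametrized:
  "\<exists>g :: (nat \<Rightarrow> nat) \<Rightarrow> fcode. \<forall>t. of_class \<beta> t \<longrightarrow> t \<in> range g"
proof (induction \<beta> rule: less_induct)
  case (less \<beta>)
  then obtain g :: "omega1 \<Rightarrow> (nat \<Rightarrow> nat) \<Rightarrow> fcode"
    where g: "\<And>\<gamma> t. \<gamma> < \<beta> \<Longrightarrow> of_class \<gamma> t \<Longrightarrow> t \<in> range (g \<gamma>)"
    by metis
  \<comment> \<open>Entry \<open>0\<close> of \<open>w\<close> holds the kind of the node, hence the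
    \<open>Suc\<close>.\<close>
  define row where "row w n k = w (Suc (prod_encode (n, k)))" for w :: "nat \<Rightarrow> nat" and n k
  define child where "child w n = g (from_nat_into {..<\<beta>} (row w n 0)) (\<lambda>k. row w n (Suc k))" for w n
  \<comment> \<open>A row contributes a point to the leaf only if it begins with \<open>1\<close>,
    so that the empty set has a parameter too.\<close>
  define G where "G w = (if w 0 = 0 then Leaf {p. \<exists>n. row w n 0 = 1 \<and> p = (\<lambda>k. row w n (Suc k))}
    else if w 0 = 1 then Join (child w) else Meet (child w))" for w
  have rows: "\<exists>w. w 0 = c \<and> (\<forall>n. row w n = r n)" for c and r :: "nat \<Rightarrow> nat \<Rightarrow> nat"
    by (intro exI[of _ "case_nat c (\<lambda>i. case prod_decode i of (n, k) \<Rightarrow> r n k)"])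
       (auto simp: row_def)
  have children: "\<exists>w. w 0 = c \<and> child w = f" if f: "\<And>n. \<exists>\<gamma><\<beta>. of_class \<gamma> (f n)" for c f
  proof -
    have "\<exists>r. f n = g (from_nat_into {..<\<beta>} (r 0)) (\<lambda>k. r (Suc k))" for n
    proof -
      obtain \<gamma> where \<gamma>: "\<gamma> < \<beta>" "of_class \<gamma> (f n)" using f by blast
      then obtain v where v: "f n = g \<gamma> v" using g by blast
      obtain i where "from_nat_into {..<\<beta>} i = \<gamma>"
        using from_nat_into_surj[OF countable_below, of \<gamma> \<beta>] \<gamma>(1) by auto
      with v show ?thesis by (intro exI[of _ "case_nat i v"]) simp
    qed
    then obtain r where r: "\<And>n. f n = g (from_nat_into {..<\<beta>} (r n 0)) (\<lambda>k. r n (Suc k))"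
      by metis
    obtain w where "w 0 = c" "\<forall>n. row w n = r n" using rows by blast
    then show ?thesis using r by (intro exI[of _ w]) (auto simp: child_def)
  qed
  have "t \<in> range G" if "of_class \<beta> t" for t
    using that
  proof (cases rule: of_class.cases)
    case (of_class_Leaf A)
    obtain r :: "nat \<Rightarrow> nat \<Rightarrow> nat" where r: "A = {p. \<exists>n. r n 0 = 1 \<and> p = (\<lambda>k. r n (Suc k))}"
    proof (cases "A = {}")
      case True
      then show ?thesis using that[of "\<lambda>_ _. 0"] by simp
    next
      case False
      then have "A = range (from_nat_into A)" using of_class_Leaf by (simp add: range_from_nat_into)
      then show ?thesis using that[of "\<lambda>n. case_nat 1 (from_nat_into A n)"] by auto
    qed
    obtain w where "w 0 = 0" "\<forall>n. row w n = r n" using rows by blast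
    then have "G w = t" using r of_class_Leaf by (simp add: G_def)
    then show ?thesis by blast
  next
    case (of_class_Join f)
    then obtain w where "w 0 = 1" "child w = f" using children by blast
    then have "G w = t" using of_class_Join by (simp add: G_def)
    then show ?thesis by blast
  next
    case (of_class_Meet f)
    then obtain w where "w 0 = 2" "child w = f" using children by blast
    then have "G w = t" using of_class_Meet by (simp add: G_def)
    then show ?thesis by blast
  qed
  then show ?case by blast
qed

section \<open>Brooms, their trees and their limits\<close>

text \<open>
  The index \<open>m\<close> confines the broom to \<open>znear z m\<close>; as it grows along the parts of a broom for a
  \<open>Meet\<close>, their union still converges to \<open>z\<close>.
\<close>

inductive broom :: "(nat \<Rightarrow> nat) \<Rightarrow> fcode \<Rightarrow> nat list \<Rightarrow> nat \<Rightarrow> (nat \<Rightarrow> nat) set \<Rightarrow> bool"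
  for z
  where
    broom_Leaf: "(\<And>k. p k \<in> A \<inter> ycyl (h @ [k]) \<inter> znear z (m + k)) \<Longrightarrow>
      broom z (Leaf A) h m (range p)"
  | broom_Join: "broom z (f n) h m E \<Longrightarrow> broom z (Join f) h m E"
  | broom_Meet: "(\<And>n. prefix (h @ [n]) (g n)) \<Longrightarrow> (\<And>n. broom z (f n) (g n) (m + n) (E n)) \<Longrightarrow>
      broom z (Meet f) h m (\<Union>n. E n)"

lemma broom_subset: "broom z t h m E \<Longrightarrow> E \<subseteq> ycyl h \<inter> znear z m"
proof (induction rule: broom.induct)
  case (broom_Leaf p A h m)
  have "p k \<in> ycyl h \<inter> znear z m" for k
    using broom_Leaf[of k] ycyl_mono[of h "h @ [k]"] znear_mono[of m "m + k" z] by auto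
  then show ?case by blast
next
  case (broom_Meet h g f m E)
  have "E n \<subseteq> ycyl h \<inter> znear z m" for n
  proof -
    have "prefix h (g n)" using broom_Meet.hyps(1)[of n] by (metis append_prefixD)
    then show ?thesis
      using broom_Meet.IH[of n] ycyl_mono[of h "g n"] znear_mono[of m "m + n" z] by auto
  qed
  then show ?case by blast
qed

text \<open>Only parts with index below \<open>k\<close> can leave \<open>znear z k\<close>, and by
  induction each of them leaves it in finitely many points.\<close>

lemma broom_convergent: "broom z t h m E \<Longrightarrow> finite (E - znear z k)"
proof (induction rule: broom.induct)
  case (broom_Leaf p A h m)
  have "range p - znear z k \<subseteq> p ` {..<k}"
  proof
    fix d assume "d \<in> range p - znear z k"
    then obtain i where i: "d = p i" "p i \<notin> znear z k" by blast
    then have "\<not> k \<le> m + i" using broom_Leaf[of i] znear_mono[of k "m + i" z] by blast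
    then show "d \<in> p ` {..<k}" using i by auto
  qed
  then show ?case by (rule finite_subset) simp
next
  case (broom_Meet h g f m E)
  have "(\<Union>n. E n) - znear z k \<subseteq> (\<Union>n\<in>{..<k}. E n - znear z k)"
  proof
    fix d assume "d \<in> (\<Union>n. E n) - znear z k"
    then obtain n where n: "d \<in> E n" "d \<notin> znear z k" by blast
    then have "\<not> k \<le> m + n"
      using broom_subset[OF broom_Meet.hyps(2)[of n]] znear_mono[of k "m + n" z] by blast
    then show "d \<in> (\<Union>n\<in>{..<k}. E n - znear z k)" using n by auto
  qed
  then show ?case by (rule finite_subset) (rule finite_UN_I[OF finite_lessThan broom_Meet.IH])
qed

lemma broom_infinite: "broom z t h m E \<Longrightarrow> infinite E"
proof (induction rule: broom.induct)
  case (broom_Leaf p A h m)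
  have "inj p"
  proof (rule injI)
    fix i j assume "p i = p j"
    then have "p i \<in> ycyl (h @ [i])" "p i \<in> ycyl (h @ [j])"
      using broom_Leaf[of i] broom_Leaf[of j] by auto
    then have "prefix (h @ [i]) (h @ [j]) \<or> prefix (h @ [j]) (h @ [i])"
      by (rule ycyl_comparable)
    then show "i = j" by auto
  qed
  then show ?case by (rule range_inj_infinite)
next
  case (broom_Meet h g f m E)
  then show ?case by (meson UNIV_I UN_upper finite_subset)
qed

text \<open>If \<open>p k\<close> lies over a node \<open>s\<close> that is no initial segment of
  \<open>h\<close>, then \<open>h @ [k]\<close> is an initial segment of \<open>s\<close>. So
  \<open>s\<close> determines \<open>k\<close>, and at most one point lies over
  \<open>s\<close>.\<close>

lemma inf_tree_broom_Leaf:
  assumes "\<And>k. p k \<in> ycyl (h @ [k])"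
  shows "inf_tree (range p) \<subseteq> {s. prefix s h}"
proof (rule subsetI, rule ccontr)
  fix s assume s: "s \<in> inf_tree (range p)" "s \<notin> {s. prefix s h}"
  have le: "prefix (h @ [k]) s" if "p k \<in> ycyl s" for k
    using ycyl_comparable[OF assms[of k] that] s(2)
    by (metis mem_Collect_eq prefix_order.refl prefix_snoc)
  have "p ` {k. p k \<in> ycyl s} \<subseteq> p ` {s ! length h}"
  proof (rule image_mono, rule subsetI)
    fix k assume "k \<in> {k. p k \<in> ycyl s}"
    then have "prefix (h @ [k]) s" using le by blast
    then show "k \<in> {s ! length h}" by (auto simp: prefix_def)
  qed
  moreover have "range p \<inter> ycyl s = p ` {k. p k \<in> ycyl s}" by blast
  ultimately have "finite (range p \<inter> ycyl s)" by (simp add: finite_subset)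
  then show False using s(1) by (simp add: inf_tree_def)
qed

text \<open>At a \<open>Meet\<close>, a node of the tree that is no initial segment of
  \<open>h\<close> lies above a single \<open>h @ [n]\<close> and sees only one part; a smaller odd
  derivative of that part contains only initial segments of \<open>g n\<close>, which bounds the
  lengths. A \<open>Join\<close> keeps the broom of one child of smaller class, so an odd order is
  available also for even \<open>\<beta>\<close>.\<close>

lemma tree_deriv_broom:
  "broom z t h m E \<Longrightarrow> of_class \<beta> t \<Longrightarrow>
    \<exists>\<gamma>\<le>\<beta>. \<not> even_ord \<gamma> \<and> tree_deriv \<gamma> (inf_tree E) \<subseteq> {s. prefix s h}"
proof (induction arbitrary: \<beta> rule: broom.induct)
  case (broom_Leaf p A h m)
  have "inf_tree (range p) \<subseteq> {s. prefix s h}"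
    using broom_Leaf by (intro inf_tree_broom_Leaf) blast
  moreover have "ord_of_nat 1 \<le> \<beta>" using broom_Leaf.prems by (elim of_class_LeafE) simp
  ultimately show ?case
    using even_ord_of_nat[of 1] by (intro exI[of _ "ord_of_nat 1"]) (simp add: tree_deriv_one del: One_nat_def)
next
  case (broom_Join f n h m E)
  from broom_Join.prems obtain \<gamma> where "\<gamma> < \<beta>" "of_class \<gamma> (f n)"
    by (elim of_class_JoinE) metis
  then show ?case using broom_Join.IH[of \<gamma>] by (meson less_imp_le order_trans)
next
  case (broom_Meet h g f m E)
  from broom_Meet.prems have odd: "\<not> even_ord \<beta>" by (elim of_class_MeetE)
  have "\<exists>\<gamma><\<beta>. \<not> even_ord \<gamma> \<and> tree_deriv \<gamma> (inf_tree (E n)) \<subseteq> {s. prefix s (g n)}" for n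
  proof -
    from broom_Meet.prems obtain \<gamma> where \<gamma>: "\<gamma> < \<beta>" "of_class \<gamma> (f n)"
      by (elim of_class_MeetE) metis
    show ?thesis using broom_Meet.IH[OF \<gamma>(2)] \<gamma>(1) by (meson order_le_less_trans)
  qed
  then obtain \<gamma> where \<gamma>: "\<And>n. \<gamma> n < \<beta>" "\<And>n. \<not> even_ord (\<gamma> n)"
    "\<And>n. tree_deriv (\<gamma> n) (inf_tree (E n)) \<subseteq> {s. prefix s (g n)}"
    by metis
  have sub: "E n \<subseteq> ycyl (g n)" for n using broom_subset[OF broom_Meet.hyps(2)] by blast
  have sub': "E n \<subseteq> ycyl (h @ [n])" for n
    using sub[of n] ycyl_mono[OF broom_Meet.hyps(1)] by blast
  \<comment> \<open>Different parts lie over incompatible nodes \<open>h @ [k]\<close>, so above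
    \<open>h @ [n]\<close> only the \<open>n\<close>-th part is visible.\<close>
  have local: "(\<Union>n. E n) \<inter> ycyl s \<subseteq> E n" if "prefix (h @ [n]) s" for s n
  proof
    fix d assume "d \<in> (\<Union>n. E n) \<inter> ycyl s"
    then obtain k where k: "d \<in> E k" "d \<in> ycyl s" by blast
    have "d \<in> ycyl (h @ [k])" "d \<in> ycyl (h @ [n])"
      using k sub'[of k] ycyl_mono[OF that] by auto
    then have "prefix (h @ [k]) (h @ [n]) \<or> prefix (h @ [n]) (h @ [k])"
      by (rule ycyl_comparable)
    then show "d \<in> E n" using k by auto
  qed
  have "prefix s h" if s: "s \<in> tree_deriv \<beta> (inf_tree (\<Union>n. E n))" for s
  proof (rule ccontr)
    assume ns: "\<not> prefix s h"
    have "infinite ((\<Union>n. E n) \<inter> ycyl s)"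
      using s tree_deriv_subset by (auto simp: inf_tree_def)
    then obtain d where "d \<in> (\<Union>n. E n) \<inter> ycyl s" by (metis ex_in_conv finite.emptyI)
    then obtain n where "d \<in> ycyl (h @ [n])" "d \<in> ycyl s" using sub' by blast
    then have n: "prefix (h @ [n]) s"
      using ycyl_comparable ns by (metis prefix_order.refl prefix_snoc)
    \<comment> \<open>Survival at \<open>\<beta>\<close> yields a node longer than
      \<open>g n\<close> in the derivative of order \<open>\<gamma> n\<close>, against the bound for
      the \<open>n\<close>-th part.\<close>
    have "\<exists>t\<in>tree_deriv (\<gamma> n) (inf_tree (\<Union>n. E n)). prefix s t \<and> Suc (length (g n)) \<le> length t"
      using s \<gamma>(1,2)[of n] unfolding tree_deriv_iff[of s \<beta>] by blast
    then obtain t where t: "t \<in> tree_deriv (\<gamma> n) (inf_tree (\<Union>n. E n))" "prefix s t"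
      "Suc (length (g n)) \<le> length t" by blast
    have "prefix (h @ [n]) t" using n t(2) by (rule prefix_order.order_trans)
    moreover have "s \<in> inf_tree (E n)" if "prefix (h @ [n]) s" "s \<in> inf_tree (\<Union>n. E n)" for s
    proof -
      have "(\<Union>n. E n) \<inter> ycyl s \<subseteq> E n \<inter> ycyl s" using local[OF that(1)] by blast
      then show ?thesis using that(2) finite_subset unfolding inf_tree_def by blast
    qed
    ultimately have "t \<in> tree_deriv (\<gamma> n) (inf_tree (E n))"
      using tree_deriv_local_mono[OF _ t(1)] by metis
    then have "prefix t (g n)" using \<gamma>(3) by blast
    then show False using t(3) prefix_length_le by fastforce
  qed
  then show ?case using odd by blast
qed

text \<open>The broom follows the code. At a \<open>Join\<close>, category selects one child and a
  longer stem. At a \<open>Meet\<close>, all children are large above each \<open>h @ [n]\<close>,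
  and each gets its own part. At a \<open>Leaf\<close>, largeness supplies points of the closed set
  over every \<open>h @ [k]\<close>, and the density of \<open>A\<close> replaces them by points of
  \<open>A\<close>.\<close>

lemma broom_exists:
  "encodes Y e t X \<Longrightarrow> nonmeager_above h {y. merge y z \<in> e -` X} \<Longrightarrow>
    \<exists>h' E. prefix h h' \<and> broom z t h' m E"
proof (induction arbitrary: h m rule: encodes.induct)
  case (encodes_Leaf X A)
  have "\<exists>d. d \<in> A \<inter> ycyl (h @ [k]) \<inter> znear z (m + k)" for k
  proof -
    obtain y where y: "merge y z \<in> e -` X" "y \<in> cyl (h @ [k])"
      using nonmeager_above_nonempty[OF encodes_Leaf.prems, of "h @ [k]"] by auto
    have "A \<inter> ycyl (h @ [k]) \<inter> znear z (m + k) \<noteq> {}"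
      by (rule encodes_Leaf.hyps(3)[OF y(1)]) (use y(2) in \<open>auto simp: ycyl_def znear_def\<close>)
    then show ?thesis by blast
  qed
  then obtain p where "\<And>k. p k \<in> A \<inter> ycyl (h @ [k]) \<inter> znear z (m + k)" by metis
  then have "broom z (Leaf A) h m (range p)" by (rule broom.broom_Leaf)
  then show ?case by blast
next
  case (encodes_Join f X)
  have "{y. merge y z \<in> e -` (\<Union>n. X n)} \<subseteq> (\<Union>n. {y. merge y z \<in> e -` X n})" by blast
  with encodes_Join.prems obtain n h' where n: "prefix h h'" "nonmeager_above h' {y. merge y z \<in> e -` X n}"
    by (rule nonmeager_above_UN)
  obtain h'' E where "prefix h' h''" "broom z (f n) h'' m E"
    using encodes_Join.IH[OF n(2)] by blast
  then show ?case using broom_Join n(1) by (meson prefix_order.order_trans)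
next
  case (encodes_Meet f X)
  have "\<exists>g E. prefix (h @ [n]) g \<and> broom z (f n) g (m + n) E" for n
    by (rule encodes_Meet.IH, rule nonmeager_above_mono[OF encodes_Meet.prems]) auto
  then obtain g E where "\<And>n. prefix (h @ [n]) (g n)" "\<And>n. broom z (f n) (g n) (m + n) (E n)"
    by metis
  then have "broom z (Meet f) h m (\<Union>n. E n)" by (rule broom.broom_Meet)
  then show ?case by blast
qed

text \<open>A broom visits what suffices for membership: one child of a \<open>Join\<close>, all
  children of a \<open>Meet\<close>, infinitely many points of the closed set of a
  \<open>Leaf\<close>. The fixed superset \<open>E'\<close> keeps the hypothesis on \<open>x\<close>
  unchanged while \<open>E\<close> shrinks to its parts.\<close>

lemma broom_limit_mem:
  "broom z t h m E \<Longrightarrow> encodes Y e t X \<Longrightarrow> E \<subseteq> E' \<Longrightarrow>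
    (\<And>C. closedin Y C \<Longrightarrow> infinite (E' \<inter> e -` C) \<Longrightarrow> x \<in> C) \<Longrightarrow> x \<in> X"
proof (induction arbitrary: X rule: broom.induct)
  case (broom_Leaf p A h m)
  from broom_Leaf.prems(1) have X: "closedin Y X" "A \<subseteq> e -` X" by (auto elim: encodes_LeafE)
  have "range p \<subseteq> E' \<inter> e -` X" using broom_Leaf.prems(2) broom_Leaf.hyps X(2) by blast
  moreover have "infinite (range p)"
    using broom_infinite[OF broom.broom_Leaf[OF broom_Leaf.hyps]] .
  ultimately show ?case using broom_Leaf.prems(3)[OF X(1)] finite_subset by blast
next
  case (broom_Join f n h m E)
  from broom_Join.prems(1) obtain Z where "X = (\<Union>n. Z n)" "encodes Y e (f n) (Z n)"
    by (auto elim: encodes_JoinE)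
  then show ?case using broom_Join.IH broom_Join.prems(2,3) by blast
next
  case (broom_Meet h g f m E)
  from broom_Meet.prems(1) obtain Z where Z: "X = (\<Inter>n. Z n)" "\<And>n. encodes Y e (f n) (Z n)"
    by (auto elim: encodes_MeetE)
  have "x \<in> Z n" for n
    using broom_Meet.IH[OF Z(2)] broom_Meet.prems(2,3) by blast
  then show ?case using Z(1) by blast
qed

text \<open>
  The second coordinate of the points of a broom converges to the parameter \<open>z\<close>, which also names
  the code of the representation that the broom defeats. So one broom for each parameter
  suffices, and brooms for different parameters are almost disjoint.
\<close>

lemma broom_family:
  assumes "ord_of_nat 1 \<le> \<beta>"
  shows "\<exists>\<E> :: (nat \<Rightarrow> nat) set set.
    (\<forall>E\<in>\<E>. infinite E) \<and>
    (\<forall>E\<in>\<E>. \<forall>E'\<in>\<E>. E \<noteq> E' \<longrightarrow> finite (E \<inter> E')) \<and>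
    (\<forall>E\<in>\<E>. [] \<notin> tree_deriv (osuc \<beta>) (inf_tree E)) \<and>
    (\<forall>(Y :: 'b topology) e X. X \<in> F_Borel Y \<beta> \<longrightarrow> range e \<subseteq> X \<longrightarrow>
      (\<exists>E\<in>\<E>. \<forall>x. (\<forall>C. closedin Y C \<longrightarrow> infinite (E \<inter> e -` C) \<longrightarrow> x \<in> C) \<longrightarrow> x \<in> X))"
proof -
  obtain g :: "(nat \<Rightarrow> nat) \<Rightarrow> fcode" where g: "\<And>t. of_class \<beta> t \<Longrightarrow> t \<in> range g"
    using of_class_parametrized by metis
  define B where "B z E \<longleftrightarrow> of_class \<beta> (g z) \<and> (\<exists>h. broom z (g z) h 0 E)" for z E
  define \<E> where "\<E> = {Eps (B z) |z. \<exists>E. B z E}"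
  have \<E>: "\<exists>z. B z E \<and> E = Eps (B z)" if E: "E \<in> \<E>" for E
    using E unfolding \<E>_def mem_Collect_eq by (metis someI)
  show ?thesis
  proof (intro exI[of _ \<E>] conjI ballI allI impI)
    fix E assume E: "E \<in> \<E>"
    then obtain z h where z: "of_class \<beta> (g z)" "broom z (g z) h 0 E"
      using \<E> unfolding B_def by blast
    show "infinite E" using broom_infinite[OF z(2)] .
  next
    fix E assume E: "E \<in> \<E>"
    then obtain z h where z: "of_class \<beta> (g z)" "broom z (g z) h 0 E"
      using \<E> unfolding B_def by blast
    obtain \<gamma> where \<gamma>: "\<gamma> \<le> \<beta>" "\<not> even_ord \<gamma>"
      "tree_deriv \<gamma> (inf_tree E) \<subseteq> {s. prefix s h}"
      using tree_deriv_broom[OF z(2,1)] by blast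
    show "[] \<notin> tree_deriv (osuc \<beta>) (inf_tree E)"
    proof
      assume "[] \<in> tree_deriv (osuc \<beta>) (inf_tree E)"
      moreover have "\<gamma> < osuc \<beta>" using \<gamma>(1) by (simp add: less_osuc_iff)
      ultimately have "\<exists>t\<in>tree_deriv \<gamma> (inf_tree E). prefix [] t \<and> Suc (length h) \<le> length t"
        using \<gamma>(2) unfolding tree_deriv_iff[of "[]" "osuc \<beta>"] by blast
      then show False using \<gamma>(3) prefix_length_le by fastforce
    qed
  next
    fix E E' assume E: "E \<in> \<E>" "E' \<in> \<E>" "E \<noteq> E'"
    obtain z z' where z: "B z E" "E = Eps (B z)" "B z' E'" "E' = Eps (B z')"
      using \<E>[OF E(1)] \<E>[OF E(2)] by blast
    then have "z \<noteq> z'" using E(3) by blast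
    then obtain i where i: "z i \<noteq> z' i" by blast
    \<comment> \<open>The parameters differ at \<open>i\<close>, so no point agrees with both of
      them on the first \<open>Suc i\<close> entries.\<close>
    have "E \<inter> E' \<subseteq> (E - znear z (Suc i)) \<union> (E' - znear z' (Suc i))"
      using i by (auto simp: znear_def)
    moreover have "finite (E - znear z (Suc i))" "finite (E' - znear z' (Suc i))"
      using z(1,3) broom_convergent unfolding B_def by blast+
    ultimately show "finite (E \<inter> E')" by (meson finite_UnI finite_subset)
  next
    fix Y :: "'b topology" and e :: "(nat \<Rightarrow> nat) \<Rightarrow> 'b" and X
    assume X: "X \<in> F_Borel Y \<beta>" "range e \<subseteq> X"
    obtain t where t: "of_class \<beta> t" "encodes Y e t X" using F_Borel_encodable[OF X(1) assms] by blast
    then obtain z where z: "t = g z" using g by blast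
    \<comment> \<open>As \<open>X\<close> contains the range of \<open>e\<close>, the section at
      \<open>z\<close> is the whole Baire space, and the construction can start from the empty
      stem.\<close>
    have "{y. merge y z \<in> e -` X} = UNIV" using X(2) by auto
    then have "nonmeager_above [] {y. merge y z \<in> e -` X}"
      using not_meager_cyl by (simp add: nonmeager_above_def)
    then obtain h E where "broom z t h 0 E" using broom_exists[OF t(2)] by blast
    then have "\<exists>E. B z E" using t(1) z unfolding B_def by blast
    then have "B z (Eps (B z))" "Eps (B z) \<in> \<E>" by (auto simp: \<E>_def intro: someI_ex)
    then show "\<exists>E\<in>\<E>. \<forall>x. (\<forall>C. closedin Y C \<longrightarrow> infinite (E \<inter> e -` C) \<longrightarrow> x \<in> C) \<longrightarrow> x \<in> X"
      using broom_limit_mem[OF _ t(2) order_refl] z unfolding B_def by blast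
  qed
qed

section \<open>Spaces with one non-isolated point\<close>

definition ideal_topology :: "'a set set \<Rightarrow> 'a option topology"
  where "ideal_topology \<E> = topology (\<lambda>U. None \<in> U \<longrightarrow>
    (\<exists>\<F> F. finite \<F> \<and> \<F> \<subseteq> \<E> \<and> finite F \<and> {d. Some d \<notin> U} \<subseteq> \<Union>\<F> \<union> F))"

lemma openin_ideal_topology:
  "openin (ideal_topology \<E>) U \<longleftrightarrow>
    (None \<in> U \<longrightarrow> (\<exists>\<F> F. finite \<F> \<and> \<F> \<subseteq> \<E> \<and> finite F \<and> {d. Some d \<notin> U} \<subseteq> \<Union>\<F> \<union> F))"
proof -
  define P where "P U \<longleftrightarrow> (\<exists>\<F> F. finite \<F> \<and> \<F> \<subseteq> \<E> \<and> finite F \<and> {d. Some d \<notin> U} \<subseteq> \<Union>\<F> \<union> F)"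
    for U :: "'a option set"
  have inter: "P (U \<inter> V)" if PU: "P U" and PV: "P V" for U V
  proof -
    obtain \<F> F where F: "finite \<F>" "\<F> \<subseteq> \<E>" "finite F" "{d. Some d \<notin> U} \<subseteq> \<Union>\<F> \<union> F"
      using PU unfolding P_def by (elim exE conjE) (rule that)
    obtain \<G> G where G: "finite \<G>" "\<G> \<subseteq> \<E>" "finite G" "{d. Some d \<notin> V} \<subseteq> \<Union>\<G> \<union> G"
      using PV unfolding P_def by (elim exE conjE) (rule that)
    have "{d. Some d \<notin> U \<inter> V} \<subseteq> \<Union>(\<F> \<union> \<G>) \<union> (F \<union> G)"
      using F(4) G(4) by auto
    then show ?thesis
      unfolding P_def using F G by (intro exI[of _ "\<F> \<union> \<G>"] exI[of _ "F \<union> G"]) simp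
  qed
  have mono: "P V" if PU: "P U" and UV: "U \<subseteq> V" for U V
  proof -
    obtain \<F> F where "finite \<F>" "\<F> \<subseteq> \<E>" "finite F" "{d. Some d \<notin> U} \<subseteq> \<Union>\<F> \<union> F"
      using PU unfolding P_def by (elim exE conjE) (rule that)
    moreover have "{d. Some d \<notin> V} \<subseteq> {d. Some d \<notin> U}" using UV by blast
    ultimately show ?thesis
      unfolding P_def by (intro exI[of _ \<F>] exI[of _ F] conjI) (assumption+, rule subset_trans)
  qed
  have "istopology (\<lambda>U. None \<in> U \<longrightarrow> P U)"
    unfolding istopology_def
  proof (intro conjI allI impI)
    fix \<K> assume \<K>: "\<forall>K\<in>\<K>. None \<in> K \<longrightarrow> P K" and "None \<in> \<Union>\<K>"
    then obtain K where K: "K \<in> \<K>" "P K" by blast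
    show "P (\<Union>\<K>)" by (rule mono[OF K(2) Union_upper[OF K(1)]])
  next
    fix U V assume "None \<in> U \<longrightarrow> P U" "None \<in> V \<longrightarrow> P V" "None \<in> U \<inter> V"
    then show "P (U \<inter> V)" using inter by blast
  qed
  then show ?thesis
    unfolding ideal_topology_def P_def by (simp add: topology_inverse')
qed

lemma topspace_ideal_topology [simp]: "topspace (ideal_topology \<E>) = UNIV"
proof -
  have "openin (ideal_topology \<E>) UNIV"
    unfolding openin_ideal_topology by (intro impI exI[of _ "{}"]) simp
  then have "UNIV \<subseteq> topspace (ideal_topology \<E>)" by (rule openin_subset)
  then show ?thesis by blast
qed

section \<open>Compactifications inside a product of two-point spaces\<close>

definition cube :: "('a set \<Rightarrow> bool) topology"
  where "cube = product_topology (\<lambda>_. discrete_topology UNIV) UNIV"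

lemma topspace_cube [simp]: "topspace cube = UNIV"
  by (simp add: cube_def)

lemma compact_space_cube: "compact_space cube"
  by (simp add: cube_def compact_space_product_topology compact_space_discrete_topology)

lemma Hausdorff_space_cube: "Hausdorff_space cube"
  by (simp add: cube_def Hausdorff_space_product_topology)

lemma openin_cube_coordinate: "openin cube {v. v A = b}"
proof -
  have "continuous_map cube (discrete_topology UNIV) (\<lambda>v. v A)"
    unfolding cube_def by (rule continuous_map_product_projection) simp
  then have "openin cube {v \<in> topspace cube. v A \<in> {b}}"
    by (rule openin_continuous_map_preimage) simp
  then show ?thesis by simp
qed

lemma closedin_cube_coordinate: "closedin cube {v. v A = b}"
proof -
  have "topspace cube - {v. v A = b} = {v. v A = (\<not> b)}" by auto
  then show ?thesis unfolding closedin_def using openin_cube_coordinate[of A "\<not> b"] by simp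
qed

text \<open>Coordinates outside \<open>\<J>\<close> are constantly false, which lets one cube serve
  all families. The point \<open>None\<close> is sent to the point with all coordinates
  false.\<close>

definition traces :: "'a set set \<Rightarrow> 'a option \<Rightarrow> 'a set \<Rightarrow> bool"
  where "traces \<J> p A \<longleftrightarrow> A \<in> \<J> \<and> (\<exists>d\<in>A. p = Some d)"

definition trace_space :: "'a set set \<Rightarrow> ('a set \<Rightarrow> bool) topology"
  where "trace_space \<J> = subtopology cube (cube closure_of range (traces \<J>))"

text \<open>Each member of \<open>\<J>\<close> is given a clopen coordinate. Singletons make the map
  injective and the images of the points \<open>Some d\<close> isolated, the members of
  \<open>\<E>\<close> supply the neighbourhoods of \<open>None\<close>, and \<open>covered\<close>
  gives continuity at \<open>None\<close>.\<close>

locale trace_family =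
  fixes \<E> \<J> :: "'a set set"
  assumes singleton_mem: "{d} \<in> \<J>"
    and family_subset: "\<E> \<subseteq> \<J>"
    and covered: "A \<in> \<J> \<Longrightarrow> \<exists>\<F> F. finite \<F> \<and> \<F> \<subseteq> \<E> \<and> finite F \<and> A \<subseteq> \<Union>\<F> \<union> F"
begin

lemma continuous_traces: "continuous_map (ideal_topology \<E>) cube (traces \<J>)"
  unfolding cube_def continuous_map_componentwise_UNIV
proof
  fix A
  have "openin (ideal_topology \<E>) {p. traces \<J> p A \<in> U}" for U
  proof (cases "A \<in> \<J>")
    case True
    then obtain \<F> F where F: "finite \<F>" "\<F> \<subseteq> \<E>" "finite F" "A \<subseteq> \<Union>\<F> \<union> F"
      using covered[OF True] by (elim exE conjE) (rule that)
    show ?thesis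
      unfolding openin_ideal_topology
    proof
      assume None: "None \<in> {p. traces \<J> p A \<in> U}"
      have "{d. Some d \<notin> {p. traces \<J> p A \<in> U}} \<subseteq> A"
      proof
        fix d assume "d \<in> {d. Some d \<notin> {p. traces \<J> p A \<in> U}}"
        then have "traces \<J> None A \<in> U" "traces \<J> (Some d) A \<notin> U"
          using None by simp_all
        then show "d \<in> A" by (cases "d \<in> A") (simp_all add: traces_def)
      qed
      also have "A \<subseteq> \<Union>\<F> \<union> F" by (rule F(4))
      finally show "\<exists>\<F> F. finite \<F> \<and> \<F> \<subseteq> \<E> \<and> finite F \<and>
          {d. Some d \<notin> {p. traces \<J> p A \<in> U}} \<subseteq> \<Union>\<F> \<union> F"
        using F(1-3) by (intro exI[of _ \<F>] exI[of _ F] conjI)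
    qed
  next
    case False
    then have "{p. traces \<J> p A \<in> U} = (if False \<in> U then UNIV else {})"
      by (auto simp: traces_def)
    then show ?thesis using openin_topspace[of "ideal_topology \<E>"] by simp
  qed
  then show "continuous_map (ideal_topology \<E>) (discrete_topology UNIV) (\<lambda>p. traces \<J> p A)"
    by (simp add: continuous_map_def)
qed

lemma inj_traces: "inj (traces \<J>)"
proof (rule injI)
  fix p q assume eq: "traces \<J> p = traces \<J> q"
  have "p = Some d \<longleftrightarrow> q = Some d" for d
    using fun_cong[OF eq, of "{d}"] singleton_mem by (simp add: traces_def)
  then show "p = q" by (metis option.exhaust)
qed

lemma embedding_traces: "embedding_map (ideal_topology \<E>) cube (traces \<J>)"
  unfolding embedding_map_def
proof (rule bijective_open_imp_homeomorphic_map)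
  show "continuous_map (ideal_topology \<E>)
      (subtopology cube (traces \<J> ` topspace (ideal_topology \<E>))) (traces \<J>)"
    using continuous_traces by (simp add: continuous_map_in_subtopology)
  show "open_map (ideal_topology \<E>)
      (subtopology cube (traces \<J> ` topspace (ideal_topology \<E>))) (traces \<J>)"
    unfolding open_map_def
  proof (intro allI impI)
    fix U assume U: "openin (ideal_topology \<E>) U"
    have "\<exists>W. openin cube W \<and> traces \<J> p \<in> W \<and> traces \<J> -` W \<subseteq> U" if p: "p \<in> U" for p
    proof (cases p)
      case None
      then obtain \<F> F where F: "finite \<F>" "\<F> \<subseteq> \<E>" "finite F" "{d. Some d \<notin> U} \<subseteq> \<Union>\<F> \<union> F"
        using U p unfolding openin_ideal_topology by (elim impE exE conjE) (simp, rule that)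
      \<comment> \<open>Requiring the coordinates in \<open>\<A>\<close> to be false is an open
        condition that \<open>None\<close> satisfies and that forces a point into \<open>U\<close>.
        The intersection with \<open>topspace cube\<close> below covers the case of empty
        \<open>\<A>\<close>.\<close>
      define \<A> where "\<A> = \<F> \<union> (\<lambda>d. {d}) ` F"
      have \<A>: "finite \<A>" "\<A> \<subseteq> \<J>" "{d. Some d \<notin> U} \<subseteq> \<Union>\<A>"
        using F family_subset singleton_mem by (auto simp: \<A>_def)
      have "openin cube (\<Inter>A\<in>\<A>. {v. v A = False})" if "\<A> \<noteq> {}"
        using \<A>(1) that by (intro openin_INT2 openin_cube_coordinate)
      then have "openin cube (topspace cube \<inter> (\<Inter>A\<in>\<A>. {v. v A = False}))"
        using openin_topspace[of cube] by (cases "\<A> = {}") auto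
      moreover have "q \<in> U" if q: "\<forall>A\<in>\<A>. \<not> traces \<J> q A" for q
      proof (cases q)
        case None
        then show ?thesis using p \<open>p = None\<close> by simp
      next
        case (Some d)
        then show ?thesis using \<A>(2,3) q by (auto simp: traces_def)
      qed
      then have "traces \<J> -` (topspace cube \<inter> (\<Inter>A\<in>\<A>. {v. v A = False})) \<subseteq> U"
        by auto
      ultimately show ?thesis
        using None by (intro exI[of _ "topspace cube \<inter> (\<Inter>A\<in>\<A>. {v. v A = False})"])
          (auto simp: traces_def)
    next
      case (Some d)
      then show ?thesis
        using openin_cube_coordinate[of "{d}" True] p singleton_mem[of d]
        by (intro exI[of _ "{v. v {d} = True}"]) (auto simp: traces_def)
    qed
    then obtain W where W: "\<And>p. p \<in> U \<Longrightarrow> openin cube (W p)" "\<And>p. p \<in> U \<Longrightarrow> traces \<J> p \<in> W p"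
      "\<And>p. p \<in> U \<Longrightarrow> traces \<J> -` W p \<subseteq> U"
      by metis
    have "openin cube (\<Union>p\<in>U. W p)" using W(1) by blast
    moreover have "traces \<J> ` U = range (traces \<J>) \<inter> (\<Union>p\<in>U. W p)"
      using W(2,3) by blast
    ultimately show "openin (subtopology cube (traces \<J> ` topspace (ideal_topology \<E>))) (traces \<J> ` U)"
      unfolding openin_subtopology by auto
  qed
  show "inj_on (traces \<J>) (topspace (ideal_topology \<E>))" using inj_traces by simp
qed simp

lemma compact_trace_space: "compact_space (trace_space \<J>)"
  unfolding trace_space_def
  by (intro compact_space_subtopology closedin_compact_space compact_space_cube closedin_closure_of)

lemma Hausdorff_trace_space: "Hausdorff_space (trace_space \<J>)"
  unfolding trace_space_def by (intro Hausdorff_space_subtopology Hausdorff_space_cube)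

lemma dense_embedding_traces: "dense_embedding (ideal_topology \<E>) (trace_space \<J>) (traces \<J>)"
proof -
  have sub: "range (traces \<J>) \<subseteq> cube closure_of range (traces \<J>)"
    by (rule closure_of_subset) simp
  then have "trace_space \<J> closure_of range (traces \<J>) = topspace (trace_space \<J>)"
    unfolding trace_space_def by (simp add: closure_of_subtopology inf.absorb2)
  moreover have "embedding_map (ideal_topology \<E>) (trace_space \<J>) (traces \<J>)"
    unfolding trace_space_def embedding_map_in_subtopology using embedding_traces sub by simp
  ultimately show ?thesis by (simp add: dense_embedding_def)
qed

lemma compactification_traces: "compactification (ideal_topology \<E>) (trace_space \<J>) (traces \<J>)"
  by (simp add: compactification_def compact_trace_space Hausdorff_trace_space dense_embedding_traces)

lemma tychonoff_trace_space: "tychonoff_space (trace_space \<J>)"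
  unfolding tychonoff_space_def
  using compact_trace_space Hausdorff_trace_space
  by (simp add: compact_Hausdorff_or_regular_imp_normal_space normal_imp_completely_regular_space)

lemma tychonoff_ideal_topology: "tychonoff_space (ideal_topology \<E>)"
proof -
  have "ideal_topology \<E> homeomorphic_space subtopology (trace_space \<J>) (range (traces \<J>))"
    using dense_embedding_traces unfolding dense_embedding_def embedding_map_def
    by (auto simp: homeomorphic_space)
  moreover have "tychonoff_space (subtopology (trace_space \<J>) (range (traces \<J>)))"
    using tychonoff_trace_space unfolding tychonoff_space_def
    by (simp add: completely_regular_space_subtopology Hausdorff_space_subtopology)
  ultimately show ?thesis
    unfolding tychonoff_space_def
    by (metis homeomorphic_Hausdorff_space homeomorphic_completely_regular_space)
qed

end

section \<open>Trees of remainder points\<close>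

lemma closure_of_meets:
  assumes "x \<in> X closure_of S" "openin X U" "x \<in> U"
  shows "\<exists>y\<in>S. y \<in> U"
  using assms unfolding in_closure_of by meson

context trace_family
begin

lemma range_traces_subset: "range (traces \<J>) \<subseteq> topspace (trace_space \<J>)"
  using dense_embedding_subset[OF dense_embedding_traces] by simp

lemma openin_trace_coordinate: "openin (trace_space \<J>) {v \<in> topspace (trace_space \<J>). v A}"
proof -
  have "{v \<in> topspace (trace_space \<J>). v A} = {v. v A = True} \<inter> topspace (trace_space \<J>)" by auto
  then show ?thesis
    using openin_cube_coordinate[of A True]
    by (simp add: trace_space_def openin_subtopology_Int inf_commute)
qed

lemma closedin_trace_coordinate: "closedin (trace_space \<J>) {v \<in> topspace (trace_space \<J>). v A}"
  unfolding trace_space_def closedin_subtopology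
  using closedin_cube_coordinate[of A True] by (intro exI[of _ "{v. v A = True}"]) auto

text \<open>The coordinate \<open>A\<close> defines an open set, so near \<open>v\<close> only those
  points of \<open>B\<close> matter that lie in \<open>A\<close>.\<close>

lemma closure_of_traces_coordinate:
  assumes "v \<in> trace_space \<J> closure_of (traces \<J> ` Some ` B)" "v A"
  shows "v \<in> trace_space \<J> closure_of (traces \<J> ` Some ` (A \<inter> B))"
  unfolding in_closure_of
proof (intro conjI allI impI)
  show v: "v \<in> topspace (trace_space \<J>)" using assms(1) by (simp add: in_closure_of)
  fix U assume U: "v \<in> U \<and> openin (trace_space \<J>) U"
  then have "openin (trace_space \<J>) (U \<inter> {v \<in> topspace (trace_space \<J>). v A})"
    using openin_trace_coordinate by (simp add: openin_Int)
  moreover have "v \<in> U \<inter> {v \<in> topspace (trace_space \<J>). v A}" using U v assms(2) by simp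
  ultimately have "\<exists>w\<in>traces \<J> ` Some ` B. w \<in> U \<inter> {v \<in> topspace (trace_space \<J>). v A}"
    by (rule closure_of_meets[OF assms(1)])
  then show "\<exists>w. w \<in> traces \<J> ` Some ` (A \<inter> B) \<and> w \<in> U"
    by (auto simp: traces_def)
qed

lemma coordinate_if_closure_of:
  assumes "v \<in> trace_space \<J> closure_of (traces \<J> ` Some ` A)" "A \<in> \<J>"
  shows "v A"
proof -
  have "traces \<J> ` Some ` A \<subseteq> {v \<in> topspace (trace_space \<J>). v A}"
    using assms(2) range_traces_subset by (auto simp: traces_def)
  then have "trace_space \<J> closure_of (traces \<J> ` Some ` A) \<subseteq> {v \<in> topspace (trace_space \<J>). v A}"
    using closedin_trace_coordinate by (rule closure_of_minimal)
  then show ?thesis using assms(1) by blast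
qed

lemma infinite_if_closure_of:
  assumes "v \<in> trace_space \<J> closure_of (traces \<J> ` Some ` A)" "v \<notin> range (traces \<J>)"
  shows "infinite A"
proof
  assume "finite A"
  then have "closedin (trace_space \<J>) (traces \<J> ` Some ` A)"
    using range_traces_subset by (intro closedin_Hausdorff_finite[OF Hausdorff_trace_space]) auto
  then have "v \<in> traces \<J> ` Some ` A" using assms(1) by (simp add: closure_of_closedin)
  then show False using assms(2) by blast
qed

text \<open>Since \<open>v\<close> is not the image of \<open>None\<close>, some coordinate
  \<open>A\<close> of \<open>v\<close> is true. By density \<open>v\<close> is approximated by
  images of points at which this coordinate is true, and these are points of
  \<open>A\<close>.\<close>

lemma remainder_coordinate:
  assumes v: "v \<in> topspace (trace_space \<J>)" "v \<notin> range (traces \<J>)"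
  obtains A where "A \<in> \<J>" "v \<in> trace_space \<J> closure_of (traces \<J> ` Some ` A)"
proof -
  have "v \<noteq> traces \<J> None" using v(2) by blast
  then obtain A where A: "v A" by (auto simp: traces_def fun_eq_iff)
  have dense: "trace_space \<J> closure_of range (traces \<J>) = topspace (trace_space \<J>)"
    using dense_embedding_traces by (simp add: dense_embedding_def)
  have meets: "\<exists>d\<in>A. A \<in> \<J> \<and> traces \<J> (Some d) \<in> U" if "openin (trace_space \<J>) U" "v \<in> U" for U
  proof -
    have "openin (trace_space \<J>) (U \<inter> {v \<in> topspace (trace_space \<J>). v A})"
      using openin_trace_coordinate that by (simp add: openin_Int)
    moreover have "v \<in> U \<inter> {v \<in> topspace (trace_space \<J>). v A}" using that v A by simp
    moreover have "v \<in> trace_space \<J> closure_of range (traces \<J>)" using dense v(1) by simp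
    ultimately have "\<exists>w\<in>range (traces \<J>). w \<in> U \<inter> {v \<in> topspace (trace_space \<J>). v A}"
      by (intro closure_of_meets[of v])
    then obtain p where "traces \<J> p \<in> U" "traces \<J> p A" by auto
    then show ?thesis by (auto simp: traces_def[of _ p A])
  qed
  have "A \<in> \<J>" using meets[OF openin_topspace v(1)] by blast
  moreover have "v \<in> trace_space \<J> closure_of (traces \<J> ` Some ` A)"
    unfolding in_closure_of using meets v(1) by auto
  ultimately show ?thesis by (rule that)
qed

end

section \<open>The class of the space in arbitrary Hausdorff extensions\<close>

definition cyl_closure :: "'b topology \<Rightarrow> ((nat \<Rightarrow> nat) option \<Rightarrow> 'b) \<Rightarrow> nat list \<Rightarrow> 'b set"
  where "cyl_closure Y e s = Y closure_of (e ` Some ` ycyl s)"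

lemma prefix_closed_cyl_closure: "prefix_closed {s. x \<in> cyl_closure Y e s}"
  unfolding prefix_closed_def
proof (intro allI impI)
  fix s t assume "t \<in> {s. x \<in> cyl_closure Y e s}" "prefix s t"
  moreover have "cyl_closure Y e t \<subseteq> cyl_closure Y e s" if "prefix s t"
    unfolding cyl_closure_def using ycyl_mono[OF that] by (intro closure_of_mono image_mono)
  ultimately show "s \<in> {s. x \<in> cyl_closure Y e s}" by blast
qed

text \<open>The space is recovered as the set of points whose tree keeps its root: a point
  \<open>Some d\<close> has the branch \<open>ycoord d\<close>, and remainder points lose the root
  by \<open>thin\<close>.\<close>

lemma F_Borel_if_remainder_trees_thin:
  assumes e: "dense_embedding (ideal_topology \<E>) Y e" and Y: "Hausdorff_space Y"
    and odd: "\<not> even_ord \<beta>"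
    and thin: "\<And>x. x \<in> topspace Y \<Longrightarrow> x \<notin> range e \<Longrightarrow> [] \<notin> tree_deriv \<beta> {s. x \<in> cyl_closure Y e s}"
  shows "range e \<in> F_Borel Y \<beta>"
proof -
  have sub: "range e \<subseteq> topspace Y" using dense_embedding_subset[OF e] by simp
  \<comment> \<open>Adding \<open>e None\<close> gives this point the full tree and leaves the tree
    of every other point unchanged.\<close>
  define C where "C s = cyl_closure Y e s \<union> {e None}" for s
  have C: "closedin Y (C s)" for s
    using sub unfolding C_def cyl_closure_def
    by (intro closedin_Un closedin_closure_of closedin_Hausdorff_singleton[OF Y]) auto
  have "[] \<in> tree_deriv \<beta> {s. e p \<in> C s}" for p
  proof (cases p)
    case None
    then have "{s. e p \<in> C s} = UNIV" by (simp add: C_def)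
    then show ?thesis using branch_in_tree_deriv[of _ UNIV 0 \<beta>] by simp
  next
    case (Some d)
    have "map (ycoord d) [0..<n] \<in> {s. e p \<in> C s}" for n
    proof -
      have "e p \<in> e ` Some ` ycyl (map (ycoord d) [0..<n])"
        using map_in_cyl Some by (auto simp: ycyl_def)
      moreover have "e ` Some ` ycyl (map (ycoord d) [0..<n]) \<subseteq> cyl_closure Y e (map (ycoord d) [0..<n])"
        unfolding cyl_closure_def using sub by (intro closure_of_subset) auto
      ultimately show ?thesis unfolding C_def by blast
    qed
    from branch_in_tree_deriv[OF this, of 0 \<beta>] show ?thesis by simp
  qed
  moreover have "x \<in> range e" if x: "x \<in> topspace Y" "[] \<in> tree_deriv \<beta> {s. x \<in> C s}" for x
  proof (rule ccontr)
    assume nx: "x \<notin> range e"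
    then have "{s. x \<in> C s} = {s. x \<in> cyl_closure Y e s}" by (auto simp: C_def)
    then show False using thin[OF x(1) nx] x(2) by simp
  qed
  ultimately have "range e = {x \<in> topspace Y. [] \<in> tree_deriv \<beta> {s. x \<in> C s}}"
    using sub by blast
  then show ?thesis using F_Borel_tree_deriv[of Y C, OF C odd, of "[]"] by simp
qed

text \<open>Separate \<open>x\<close> from \<open>e None\<close>. The neighbourhood of
  \<open>e None\<close> omits only points of finitely many members of \<open>\<E>\<close> and of a
  finite set, so near \<open>x\<close> no other isolated points occur.\<close>

lemma remainder_tree_subset:
  assumes e: "dense_embedding (ideal_topology \<E>) Y e" and Y: "Hausdorff_space Y"
    and x: "x \<in> topspace Y" "x \<notin> range e"
  obtains \<F> where "finite \<F>" "\<F> \<subseteq> \<E>" "{s. x \<in> cyl_closure Y e s} \<subseteq> inf_tree (\<Union>\<F>)"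
proof -
  have sub: "range e \<subseteq> topspace Y" using dense_embedding_subset[OF e] by simp
  have "x \<noteq> e None" "e None \<in> topspace Y" using x(2) sub by auto
  then obtain U V where UV: "openin Y U" "openin Y V" "x \<in> U" "e None \<in> V" "disjnt U V"
    using Y x(1) unfolding Hausdorff_space_def by metis
  have "continuous_map (ideal_topology \<E>) Y e"
    using e unfolding dense_embedding_def embedding_map_def
    by (meson continuous_map_in_subtopology homeomorphic_imp_continuous_map)
  then have "openin (ideal_topology \<E>) {p \<in> topspace (ideal_topology \<E>). e p \<in> V}"
    using UV(2) by (rule openin_continuous_map_preimage)
  then have "\<exists>\<F> F. finite \<F> \<and> \<F> \<subseteq> \<E> \<and> finite F \<and> {d. Some d \<notin> {p. e p \<in> V}} \<subseteq> \<Union>\<F> \<union> F"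
    using UV(4) unfolding openin_ideal_topology by simp
  then obtain \<F> F where F: "finite \<F>" "\<F> \<subseteq> \<E>" "finite F"
    "{d. Some d \<notin> {p. e p \<in> V}} \<subseteq> \<Union>\<F> \<union> F"
    by (elim exE conjE) (rule that)
  have "infinite (\<Union>\<F> \<inter> ycyl s)" if s: "x \<in> cyl_closure Y e s" for s
  proof
    assume "finite (\<Union>\<F> \<inter> ycyl s)"
    then have "finite (e ` Some ` ((\<Union>\<F> \<inter> ycyl s) \<union> F))" using F(3) by simp
    then have "closedin Y (e ` Some ` ((\<Union>\<F> \<inter> ycyl s) \<union> F))"
      using sub by (intro closedin_Hausdorff_finite[OF Y]) auto
    \<comment> \<open>Since \<open>x\<close> is outside the range, finitely many image points can be
      removed from its neighbourhood.\<close>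
    then have "openin Y (U - e ` Some ` ((\<Union>\<F> \<inter> ycyl s) \<union> F))"
      using UV(1) by (rule openin_diff[rotated])
    moreover have "x \<in> U - e ` Some ` ((\<Union>\<F> \<inter> ycyl s) \<union> F)" using UV(3) x(2) by blast
    ultimately have "\<exists>w\<in>e ` Some ` ycyl s. w \<in> U - e ` Some ` ((\<Union>\<F> \<inter> ycyl s) \<union> F)"
      using s unfolding cyl_closure_def by (intro closure_of_meets)
    then obtain d where d: "d \<in> ycyl s" "e (Some d) \<in> U - e ` Some ` ((\<Union>\<F> \<inter> ycyl s) \<union> F)"
      by blast
    have "e (Some d) \<notin> V" using d(2) UV(5) by (auto simp: disjnt_iff)
    then have "d \<in> \<Union>\<F> \<union> F" using F(4) by blast
    then show False using d by blast
  qed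
  then show ?thesis using that[OF F(1,2)] by (auto simp: inf_tree_def)
qed

lemma absolute_F_space_ideal_topology:
  assumes "\<And>E. E \<in> \<E> \<Longrightarrow> [] \<notin> tree_deriv \<beta> (inf_tree E)" "\<not> even_ord \<beta>"
  shows "absolute_F_space \<beta> (ideal_topology \<E>)"
  unfolding absolute_F_space_def
proof (intro allI impI)
  fix Y :: "(nat \<Rightarrow> nat) option set set topology" and e
  assume Y: "tychonoff_space Y \<and> dense_embedding (ideal_topology \<E>) Y e"
  then have haus: "Hausdorff_space Y" by (simp add: tychonoff_space_def)
  have "range e \<in> F_Borel Y \<beta>"
  proof (rule F_Borel_if_remainder_trees_thin[OF _ haus assms(2)])
    show e: "dense_embedding (ideal_topology \<E>) Y e" using Y by blast
    fix x assume "x \<in> topspace Y" "x \<notin> range e"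
    then obtain \<F> where F: "finite \<F>" "\<F> \<subseteq> \<E>" "{s. x \<in> cyl_closure Y e s} \<subseteq> inf_tree (\<Union>\<F>)"
      using remainder_tree_subset[OF e haus] by metis
    have "[] \<notin> tree_deriv \<beta> (inf_tree (\<Union>\<F>))"
      using F(2) assms(1) by (intro Nil_notin_tree_deriv_inf_tree_Union F(1)) blast
    then show "[] \<notin> tree_deriv \<beta> {s. x \<in> cyl_closure Y e s}"
      using tree_deriv_mono[OF F(3)] by blast
  qed
  then show "e ` topspace (ideal_topology \<E>) \<in> F_Borel Y \<beta>" by simp
qed

section \<open>An F-sigma-delta representation in a fine compactification\<close>

lemma unbounded_chain_branch:
  fixes S :: "nat list set"
  assumes "\<And>n. \<exists>t\<in>S. n \<le> length t" "\<And>s t. s \<in> S \<Longrightarrow> t \<in> S \<Longrightarrow> prefix s t \<or> prefix t s"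
    "prefix_closed S"
  obtains y where "\<And>n. map y [0..<n] \<in> S"
proof -
  obtain t where t: "\<And>n. t n \<in> S" "\<And>n. n \<le> length (t n)" using assms(1) by metis
  define y where "y n = t (Suc n) ! n" for n
  have "map y [0..<n] = take n (t n)" for n
  proof (rule nth_equalityI)
    show "length (map y [0..<n]) = length (take n (t n))" using t(2)[of n] by simp
    fix i assume "i < length (map y [0..<n])"
    then have "i < n" by simp
    then have "i < length (t n)" "i < length (t (Suc i))" using t(2)[of n] t(2)[of "Suc i"] by auto
    then have "t (Suc i) ! i = t n ! i"
      using assms(2)[OF t(1)[of n] t(1)[of "Suc i"]] by (auto simp: prefix_def nth_append)
    then show "map y [0..<n] ! i = take n (t n) ! i" using \<open>i < n\<close> by (simp add: y_def)
  qed
  moreover have "take n (t n) \<in> S" for n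
    using assms(3) t(1)[of n] take_is_prefix unfolding prefix_closed_def by blast
  ultimately show ?thesis using that[of y] by simp
qed

text \<open>Every \<open>E \<inter> ycyl s\<close> gets a clopen coordinate, so a remainder point
  cannot adhere to two incompatible parts of \<open>E\<close>, and its tree is a chain. An unbounded
  chain would be a branch of \<open>inf_tree E\<close>, which the vanishing derivative forbids. So
  the lengths are bounded, and the root is lost at order 3.\<close>

lemma F_sigma_delta_space_ideal_topology:
  assumes "\<And>E. E \<in> \<E> \<Longrightarrow> [] \<notin> tree_deriv \<beta> (inf_tree E)"
  shows "F_space (ord_of_nat 3) (ideal_topology \<E>)"
proof -
  define \<J> where "\<J> = {E \<inter> ycyl s |E s. E \<in> \<E>} \<union> range (\<lambda>d. {d})"
  interpret trace_family \<E> \<J>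
  proof
    have "E \<inter> ycyl [] = E" for E by (simp add: ycyl_def)
    then show "\<E> \<subseteq> \<J>" unfolding \<J>_def by blast
    fix A assume "A \<in> \<J>"
    then consider E s where "E \<in> \<E>" "A = E \<inter> ycyl s" | d where "A = {d}"
      unfolding \<J>_def by blast
    then show "\<exists>\<F> F. finite \<F> \<and> \<F> \<subseteq> \<E> \<and> finite F \<and> A \<subseteq> \<Union>\<F> \<union> F"
    proof cases
      case (1 E s)
      then show ?thesis by (intro exI[of _ "{E}"] exI[of _ "{}"]) auto
    next
      case (2 d)
      then show ?thesis by (intro exI[of _ "{}"] exI[of _ "{d}"]) auto
    qed
  qed (simp add: \<J>_def)
  let ?K = "trace_space \<J>"
  have odd: "\<not> even_ord (ord_of_nat 3)" by (simp add: even_ord_of_nat)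
  have "range (traces \<J>) \<in> F_Borel ?K (ord_of_nat 3)"
  proof (rule F_Borel_if_remainder_trees_thin[OF dense_embedding_traces Hausdorff_trace_space odd])
    fix v assume v: "v \<in> topspace ?K" "v \<notin> range (traces \<J>)"
    obtain A where A: "A \<in> \<J>" "v \<in> ?K closure_of (traces \<J> ` Some ` A)"
      using remainder_coordinate[OF v] .
    have "infinite A" using infinite_if_closure_of[OF A(2) v(2)] .
    \<comment> \<open>The singletons in \<open>\<J>\<close> are ruled out because \<open>A\<close>
      is infinite.\<close>
    then obtain E s where E: "E \<in> \<E>" "A = E \<inter> ycyl s" using A(1) unfolding \<J>_def by auto
    have "?K closure_of (traces \<J> ` Some ` A) \<subseteq> ?K closure_of (traces \<J> ` Some ` E)"
      using E(2) by (intro closure_of_mono image_mono) blast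
    then have vE: "v E" using coordinate_if_closure_of[of v E] A(2) E(1) family_subset by blast
    define S where "S = {s. v \<in> cyl_closure ?K (traces \<J>) s}"
    have S: "v (E \<inter> ycyl t) \<and> infinite (E \<inter> ycyl t)" if "t \<in> S" for t
    proof -
      have "v \<in> ?K closure_of (traces \<J> ` Some ` (E \<inter> ycyl t))"
        using that vE unfolding S_def cyl_closure_def
        by (intro closure_of_traces_coordinate) auto
      then show ?thesis
        using coordinate_if_closure_of infinite_if_closure_of v(2) E(1) unfolding \<J>_def by blast
    qed
    have chain: "prefix s t \<or> prefix t s" if st: "s \<in> S" "t \<in> S" for s t
    proof -
      have "v \<in> ?K closure_of (traces \<J> ` Some ` ycyl t)"
        using st(2) by (simp add: S_def cyl_closure_def)
      then have "v \<in> ?K closure_of (traces \<J> ` Some ` ((E \<inter> ycyl s) \<inter> ycyl t))"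
        using S[OF st(1)] by (intro closure_of_traces_coordinate) auto
      then have "infinite ((E \<inter> ycyl s) \<inter> ycyl t)" using infinite_if_closure_of v(2) by blast
      then obtain d where "d \<in> (E \<inter> ycyl s) \<inter> ycyl t" by (metis ex_in_conv finite.emptyI)
      then show ?thesis using ycyl_comparable by blast
    qed
    have "[] \<notin> tree_deriv (ord_of_nat 3) S"
    proof
      assume "[] \<in> tree_deriv (ord_of_nat 3) S"
      moreover have "ord_of_nat 1 < ord_of_nat 3" "\<not> even_ord (ord_of_nat 1)"
        using less_osuc[of "ord_of_nat 1"] less_osuc[of "ord_of_nat 2"] even_ord_of_nat[of 1]
        by (simp_all add: ord_of_nat_Suc[of 1] ord_of_nat_Suc[of 2] eval_nat_numeral ord_of_nat_Suc)
      ultimately have "\<And>n. \<exists>t\<in>tree_deriv (ord_of_nat 1) S. prefix [] t \<and> n \<le> length t"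
        unfolding tree_deriv_iff[of "[]" "ord_of_nat 3"] by blast
      then have "\<And>n. \<exists>t\<in>S. n \<le> length t" unfolding tree_deriv_one by blast
      then obtain y where "\<And>n. map y [0..<n] \<in> S"
        using unbounded_chain_branch[OF _ chain] prefix_closed_cyl_closure unfolding S_def by metis
      then have "\<And>n. map y [0..<n] \<in> inf_tree E" using S unfolding inf_tree_def by blast
      then have "map y [0..<0] \<in> tree_deriv \<beta> (inf_tree E)" by (rule branch_in_tree_deriv)
      then show False using assms[OF E(1)] by simp
    qed
    then show "[] \<notin> tree_deriv (ord_of_nat 3) {s. v \<in> cyl_closure ?K (traces \<J>) s}"
      by (simp add: S_def)
  qed
  then show ?thesis using F_spaceI[OF compactification_traces] by simp
qed

section \<open>Failure of the even class in a coarse compactification\<close>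

text \<open>The point \<open>\<lambda>A. A = E\<close> is the limit of \<open>E\<close>: any other
  member of \<open>\<J>\<close> is a singleton or almost disjoint from \<open>E\<close>, so its
  coordinate is true at only finitely many points of \<open>E\<close>. An injective sequence in
  \<open>E\<close> therefore converges to it in every coordinate.\<close>

lemma almost_disjoint_limit:
  assumes inf: "\<And>E. E \<in> \<E> \<Longrightarrow> infinite E"
    and ad: "\<And>E E'. E \<in> \<E> \<Longrightarrow> E' \<in> \<E> \<Longrightarrow> E \<noteq> E' \<Longrightarrow> finite (E \<inter> E')"
    and E: "E \<in> \<E>" and \<J>: "\<J> = \<E> \<union> range (\<lambda>d. {d})"
    and C: "closedin (trace_space \<J>) C" "infinite (E \<inter> (\<lambda>d. traces \<J> (Some d)) -` C)"
  shows "(\<lambda>A. A = E) \<in> C"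
proof -
  obtain d :: "nat \<Rightarrow> _" where d: "inj d" "range d \<subseteq> E \<inter> (\<lambda>d. traces \<J> (Some d)) -` C"
    using infinite_countable_subset[OF C(2)] by (elim exE conjE) (rule that)
  have "finite {x \<in> E. traces \<J> (Some x) A \<noteq> (A = E)}" for A
  proof -
    consider "A = E" | "A \<in> \<E>" "A \<noteq> E" | y where "A = {y}" "A \<noteq> E" | "A \<notin> \<J>"
      by (cases "A \<in> \<J>") (auto simp: \<J>)
    then show ?thesis
    proof cases
      case 1
      then have "{x \<in> E. traces \<J> (Some x) A \<noteq> (A = E)} = {}"
        using E by (auto simp: traces_def \<J>)
      then show ?thesis by (simp only: finite.emptyI)
    next
      case 2
      then have "{x \<in> E. traces \<J> (Some x) A \<noteq> (A = E)} \<subseteq> E \<inter> A"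
        by (auto simp: traces_def)
      then show ?thesis using ad[OF E 2(1) 2(2)[symmetric]] by (rule finite_subset)
    next
      case (3 y)
      then have "{x \<in> E. traces \<J> (Some x) A \<noteq> (A = E)} \<subseteq> {y}"
        by (auto simp: traces_def)
      then show ?thesis by (rule finite_subset) simp
    next
      case 4
      then have "A \<noteq> E" using E \<J> by auto
      with 4 show ?thesis by (simp add: traces_def)
    qed
  qed
  then have fin: "finite {n. traces \<J> (Some (d n)) A \<noteq> (A = E)}" for A
  proof -
    have "{n. traces \<J> (Some (d n)) A \<noteq> (A = E)} \<subseteq> d -` {x \<in> E. traces \<J> (Some x) A \<noteq> (A = E)}"
      using d(2) by auto
    moreover have "finite (d -` {x \<in> E. traces \<J> (Some x) A \<noteq> (A = E)})"
      using \<open>finite {x \<in> E. traces \<J> (Some x) A \<noteq> (A = E)}\<close> d(1) by (rule finite_vimageI)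
    ultimately show ?thesis by (rule finite_subset)
  qed
  have "limitin (discrete_topology UNIV) (\<lambda>n. traces \<J> (Some (d n)) A) (A = E) sequentially" for A
  proof -
    have ev: "\<forall>\<^sub>F n in sequentially. traces \<J> (Some (d n)) A = (A = E)"
      using fin[of A] by (simp add: eventually_cofinite flip: cofinite_eq_sequentially)
    show ?thesis
      unfolding limitin_def
    proof (intro conjI allI impI)
      fix U :: "bool set" assume "openin (discrete_topology UNIV) U \<and> (A = E) \<in> U"
      with ev show "\<forall>\<^sub>F n in sequentially. traces \<J> (Some (d n)) A \<in> U"
        by (elim eventually_mono) simp
    qed simp
  qed
  then have "limitin cube (\<lambda>n. traces \<J> (Some (d n))) (\<lambda>A. A = E) sequentially"
    unfolding cube_def limitin_componentwise by simp
  moreover have "closedin cube C"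
    using C(1) unfolding trace_space_def by (rule closedin_trans_full) (rule closedin_closure_of)
  moreover have "\<forall>\<^sub>F n in sequentially. traces \<J> (Some (d n)) \<in> C"
    using d(2) by (intro always_eventually) auto
  ultimately show ?thesis by (rule limitin_closedin) simp
qed

lemma trace_family_singletons: "trace_family \<E> (\<E> \<union> range (\<lambda>d. {d}))"
proof
  fix A assume "A \<in> \<E> \<union> range (\<lambda>d. {d})"
  then consider "A \<in> \<E>" | d where "A = {d}" by blast
  then show "\<exists>\<F> F. finite \<F> \<and> \<F> \<subseteq> \<E> \<and> finite F \<and> A \<subseteq> \<Union>\<F> \<union> F"
  proof cases
    case 1
    then show ?thesis by (intro exI[of _ "{A}"] exI[of _ "{}"]) auto
  next
    case (2 d)
    then show ?thesis by (intro exI[of _ "{}"] exI[of _ "{d}"]) auto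
  qed
qed auto

text \<open>A representation of class \<open>\<beta>\<close> in this compactification would force
  the limit of some \<open>E\<close> into the range. It is not the image of \<open>None\<close>,
  because its coordinate \<open>E\<close> is true, nor that of \<open>Some d\<close>, because then
  \<open>E\<close> would be the singleton of \<open>d\<close> and hence finite.\<close>

lemma not_absolute_F_space_ideal_topology:
  fixes \<E> :: "'a set set"
  assumes inf: "\<And>E. E \<in> \<E> \<Longrightarrow> infinite E"
    and ad: "\<And>E E'. E \<in> \<E> \<Longrightarrow> E' \<in> \<E> \<Longrightarrow> E \<noteq> E' \<Longrightarrow> finite (E \<inter> E')"
    and guess: "\<And>(Y :: ('a set \<Rightarrow> bool) topology) e X. X \<in> F_Borel Y \<beta> \<Longrightarrow> range e \<subseteq> X \<Longrightarrow>
      \<exists>E\<in>\<E>. \<forall>x. (\<forall>C. closedin Y C \<longrightarrow> infinite (E \<inter> e -` C) \<longrightarrow> x \<in> C) \<longrightarrow> x \<in> X"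
  shows "\<not> absolute_F_space \<beta> (ideal_topology \<E>)"
proof
  assume abs: "absolute_F_space \<beta> (ideal_topology \<E>)"
  define \<J> where "\<J> = \<E> \<union> range (\<lambda>d. {d})"
  interpret trace_family \<E> \<J>
    unfolding \<J>_def by (rule trace_family_singletons)
  have "range (traces \<J>) \<in> F_Borel (trace_space \<J>) \<beta>"
    using absolute_F_spaceD[OF abs tychonoff_trace_space dense_embedding_traces] by simp
  from guess[OF this, of "\<lambda>d. traces \<J> (Some d)"] obtain E where E: "E \<in> \<E>"
    "\<And>x. (\<And>C. closedin (trace_space \<J>) C \<Longrightarrow> infinite (E \<inter> (\<lambda>d. traces \<J> (Some d)) -` C) \<Longrightarrow> x \<in> C) \<Longrightarrow>
      x \<in> range (traces \<J>)"
    by auto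
  have "(\<lambda>A. A = E) \<in> range (traces \<J>)"
    by (rule E(2), rule almost_disjoint_limit[OF inf ad E(1) \<J>_def])
  then obtain p where p: "(\<lambda>A. A = E) = traces \<J> p" by blast
  show False
  proof (cases p)
    case None
    then show False using fun_cong[OF p, of E] by (simp add: traces_def)
  next
    case (Some d)
    then have "{d} = E" using fun_cong[OF p, of "{d}"] singleton_mem[of d] by (simp add: traces_def)
    then show False using inf[OF E(1)] by blast
  qed
qed

theorem theorem5p14:
  fixes \<alpha> :: omega1
  assumes "even_ord \<alpha>" and "ord_of_nat 4 \<le> \<alpha>"
  shows "\<exists>T :: (nat \<Rightarrow> nat) option topology.
    tychonoff_space T \<and>
    F_space (ord_of_nat 3) T \<and>
    \<not> absolute_F_space \<alpha> T \<and>
    absolute_F_space (osuc \<alpha>) T"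
proof -
  have "ord_of_nat 0 < \<alpha>"
  proof -
    have "ord_of_nat 0 \<le> ord_of_nat 3" by (rule ord_of_nat_0_le)
    also have "\<dots> < osuc (ord_of_nat 3)" by (rule less_osuc)
    also have "\<dots> = ord_of_nat 4" by (simp add: eval_nat_numeral ord_of_nat_Suc)
    finally show ?thesis using assms(2) by (rule less_le_trans)
  qed
  then have "osuc (ord_of_nat 0) \<le> \<alpha>" by (simp only: osuc_le_iff)
  then have one: "ord_of_nat 1 \<le> \<alpha>" by (simp only: ord_of_nat_Suc One_nat_def)
  \<comment> \<open>The brooms have to defeat all topologies on the type of cube points at once,
    because the compactification to which \<open>guess\<close> is applied is itself built from
    \<open>\<E>\<close>.\<close>
  obtain \<E> :: "(nat \<Rightarrow> nat) set set" where
    inf: "\<forall>E\<in>\<E>. infinite E" and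
    ad: "\<forall>E\<in>\<E>. \<forall>E'\<in>\<E>. E \<noteq> E' \<longrightarrow> finite (E \<inter> E')" and
    thin: "\<forall>E\<in>\<E>. [] \<notin> tree_deriv (osuc \<alpha>) (inf_tree E)" and
    guess: "\<forall>(Y :: ((nat \<Rightarrow> nat) set \<Rightarrow> bool) topology) e X.
      X \<in> F_Borel Y \<alpha> \<longrightarrow> range e \<subseteq> X \<longrightarrow>
      (\<exists>E\<in>\<E>. \<forall>x. (\<forall>C. closedin Y C \<longrightarrow> infinite (E \<inter> e -` C) \<longrightarrow> x \<in> C) \<longrightarrow> x \<in> X)"
    using broom_family[OF one, where 'b = "(nat \<Rightarrow> nat) set \<Rightarrow> bool"] by (elim exE conjE) (rule that)
  interpret trace_family \<E> "\<E> \<union> range (\<lambda>d. {d})" by (rule trace_family_singletons)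
  have "\<not> absolute_F_space \<alpha> (ideal_topology \<E>)"
    using inf ad guess by (intro not_absolute_F_space_ideal_topology) simp_all
  moreover have "absolute_F_space (osuc \<alpha>) (ideal_topology \<E>)"
    using thin assms(1) by (intro absolute_F_space_ideal_topology) (auto simp: even_ord_osuc)
  moreover have "F_space (ord_of_nat 3) (ideal_topology \<E>)"
    using thin by (intro F_sigma_delta_space_ideal_topology) blast
  ultimately show ?thesis
    using tychonoff_ideal_topology by (intro exI[of _ "ideal_topology \<E>"] conjI)
qed

end
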